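(* Let $\varepsilon, \delta > 0$ and let $C=\{x\in\mathbb{R}^n \mid \mathcal{A}(x)\succcurlyeq 0\}$ be an unbounded, closed, convex, line-free spectrahedron with nonempty interior. Then Algorithm 2 (described in the context) with input $\mathcal{A}(x)$, $\varepsilon$, $\delta$ terminates after finitely many steps.
   Context: Notation. $\|\cdot\|$ is the Euclidean norm, $\|\cdot\|_1$ the $\ell_1$-norm, $B_r(c)$ the Euclidean ball of radius $r$ centered at $c$, $0^+C$ the recession cone, $\operatorname{ext}$ the set of extreme points. A set is line-free if its recession cone is pointed. A polyhedron is a set $\operatorname{conv} V + \operatorname{cone} D$ with $V, D$ finite; $(V,D)$ is a $V$-representation; $\operatorname{vert} P$ is the set of vertices of $P$. For nonempty sets, $e[C_1,C_2] = \sup_{c_1 \in C_1} \inf_{c_2 \in C_2} \|c_1-c_2\|$ and $d_{\mathsf H}(C_1,C_2) = \max\{e[C_1,C_2], e[C_2,C_1]\}$. A polyhedron $P$ is an $\varepsilon$-approximation of a convex set $C$ if $d_{\mathsf H}(P,C)\le\varepsilon$. For nonempty closed convex cones, $\bar d_{\mathsf H}(K_1,K_2) = d_{\mathsf H}(K_1\cap B_1(0), K_2 \cap B_1(0))$. A line-free polyhedron $P$ is an $(\varepsilon,\delta)$-approximation of a nonempty closed convex line-free set $C$ if (i) $e[\operatorname{vert} P, C] \leq \varepsilon$, (ii) $\bar d_{\mathsf H}(0^+P, 0^+C) \leq \delta$, (iii) $P \supseteq C$. For symmetric matrices $A_0,\dots,A_n$ of the same size, $\bar{\mathcal{A}}(x)=\sum_{i=1}^n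 x_iA_i$ and $\mathcal{A}(x)=\bar{\mathcal{A}}(x)+A_0$; $\succcurlyeq 0$ means positive semidefinite; $A\cdot X$ is the trace of $AX$; $I$ is the identity matrix. A spectrahedron is a set $\{x\in\mathbb{R}^n\mid\mathcal{A}(x)\succcurlyeq0\}$; its recession cone is $\{x \mid \bar{\mathcal{A}}(x)\succcurlyeq 0\}$. Subproblems for a spectrahedron given by $\mathcal A$: (P$_1(w)$): $\max w^{\mathsf T}x$ s.t. $\mathcal A(x)\succcurlyeq 0$. (P$_2(v,d)$): $\min t$ s.t. $\mathcal A(x)\succcurlyeq 0$, $x-v-td=0$ (variables $x,t$). (D$_2(v,d)$): $\max -\mathcal A(v)\cdot U$ s.t. $A_i\cdot U=w_i$ ($i=1,\dots,n$), $d^{\mathsf T}w=1$, $U\succcurlyeq0$ (variables $U,w$). Algorithm 1 (cutting scheme). Input: matrix $\mathcal A(x)$ representing a compact spectrahedron $C$ with nonempty interior, error tolerance $\varepsilon$. Output: $V$-representation of a polyhedral $\varepsilon$-approximation $P$ of $C$. Let $e$ be the all-ones vector and $e_i$ the $i$-th unit vector. Compute solutions $x_w^*$ of (P$_1(w)$) for $w\in\{-e,e_1,\dots,e_n\}$; set $P=\{x \mid w^{\mathsf T}x\le w^{\mathsf T}x_w^*\ \forall w\in\{-e,e_1,\dots,e_n\}\}$; set $c=\frac{1}{n+1}\sum_w x_w^*$ (described in the algorithm as an interior point of $C$); set $\kappa=+\infty$. While $\kappa>\varepsilon$: compute $\operatorname{vert}P$; for every $v\in\operatorname{vert}P$ set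 $d=c-v$ and compute solutions $(x_v^*,t_v^* )$ and $(U_v^*,w_v^* )$ to (P$_2(v,d)$) and (D$_2(v,d)$); let $\bar v\in\operatorname{argmax}\{t_v^*\|c-v\| \mid v\in\operatorname{vert}P\}$; replace $P$ by $P\cap\{x\mid w_{\bar v}^{*\mathsf T}x\ge w_{\bar v}^{*\mathsf T}\bar v+t_{\bar v}^*\}$; set $\kappa=t_{\bar v}^*\|c-\bar v\|$. After the loop, compute and return $\operatorname{vert}P$. Algorithm 2. Input: matrix $\mathcal A(x)$ representing an unbounded closed and line-free spectrahedron $C$ with nonempty interior; error tolerances $\varepsilon$ and $\delta$. Output: $V$-representation of an $(\varepsilon,\delta)$-approximation $P$ of $C$. 1. $w \leftarrow (-A_1\cdot I,\dots,-A_n\cdot I)^{\mathsf T}/\|(-A_1\cdot I,\dots,-A_n\cdot I)^{\mathsf T}\|$. 2. $M\leftarrow 0^+C\cap\{x\in\mathbb{R}^n\mid w^{\mathsf T}x=-(1+\delta)\}$. 3. Compute a $\delta/2$-approximation $\overline M$ of $M$ according to Algorithm 1 (with the affine hull of $M$ treated as the ambient space, since $M$ is not full-dimensional). 4. $\overline M\leftarrow\overline M+\{x\in\mathbb{R}^n\mid\|x\|_1\le\delta/2\}$. 5. $K\leftarrow\operatorname{cone}\operatorname{vert}\overline M$. 6. $\overline C\leftarrow C\cap\{x\in\mathbb{R}^n\mid w^{\mathsf T}x\ge\min\{w^{\mathsf T}y\mid y\in\operatorname{conv}\operatorname{ext}(C+K)\}-\varepsilon\}$. 7. Compute an $\varepsilon$-approximation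 $\overline P$ of $\overline C$ according to Algorithm 1. 8. $P\leftarrow\overline P+K$. 9. Return a $V$-representation of $P$.
   Formalization: In Algorithm 1 the centre c is the stated average only when that average is an interior point, otherwise any interior point; if M is a single point it is its own approximation; the minimum over conv ext(C+K) in step 6 is read as an infimum. *)

theory Defs
  imports "HOL-Analysis.Analysis"
begin

definition psd :: "real^'m^'m \<Rightarrow> bool" where
  "psd X \<longleftrightarrow> transpose X = X \<and> (\<forall>y. 0 \<le> y \<bullet> (X *v y))"

definition mat_inner :: "real^'m^'m \<Rightarrow> real^'m^'m \<Rightarrow> real" where
  "mat_inner X Y = trace (X ** Y)"

definition linear_pencil :: "('n::finite \<Rightarrow> real^'m^'m) \<Rightarrow> real^'n \<Rightarrow> real^'m^'m" where
  "linear_pencil A x = (\<Sum>i\<in>UNIV. (x $ i) *\<^sub>R A i)"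

definition pencil :: "real^'m^'m \<Rightarrow> ('n::finite \<Rightarrow> real^'m^'m) \<Rightarrow> real^'n \<Rightarrow> real^'m^'m" where
  "pencil A0 A x = linear_pencil A x + A0"

definition spectrahedron :: "real^'m^'m \<Rightarrow> ('n::finite \<Rightarrow> real^'m^'m) \<Rightarrow> (real^'n) set" where
  "spectrahedron A0 A = {x. psd (pencil A0 A x)}"

definition recession_cone :: "'a::real_vector set \<Rightarrow> 'a set" where
  "recession_cone C = {d. \<forall>x\<in>C. \<forall>t\<ge>0. x + t *\<^sub>R d \<in> C}"

definition line_free :: "'a::real_vector set \<Rightarrow> bool" where
  "line_free C \<longleftrightarrow> recession_cone C \<inter> uminus ` recession_cone C = {0}"

text \<open>For polyhedra, extreme points are exactly the vertices.\<close>

definition ext :: "'a::real_vector set \<Rightarrow> 'a set" where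
  "ext S = {x. x extreme_point_of S}"

definition l1_ball :: "real \<Rightarrow> (real^'n) set" where
  "l1_ball r = {x. (\<Sum>i\<in>UNIV. \<bar>x $ i\<bar>) \<le> r}"


section \<open>The cutting scheme for compact spectrahedra\<close>

text \<open>
  The cutting scheme is run in an affine subspace L that plays the role of the ambient space.
  Cartesian coordinates on L are given by an orthonormal basis B of the direction space of L, so
  that the elements of B are the unit vectors, their sum is the all-ones vector, and the coefficient
  matrix of the pencil belonging to the coordinate direction b is \<open>linear_pencil A b\<close>. The case
  \<open>L = UNIV\<close>, \<open>B = Basis\<close> is the cutting scheme in the full space.
\<close>

definition orthonormal_frame :: "'a::euclidean_space set \<Rightarrow> 'a set \<Rightarrow> bool" where
  "orthonormal_frame L B \<longleftrightarrow>
     pairwise orthogonal B \<and> (\<forall>b\<in>B. norm b = 1) \<and> span B = {x - y | x y. x \<in> L \<and> y \<in> L}"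

definition solves_P1 :: "'a::real_inner set \<Rightarrow> 'a \<Rightarrow> 'a \<Rightarrow> bool" where
  "solves_P1 C w x \<longleftrightarrow> x \<in> C \<and> (\<forall>y\<in>C. w \<bullet> y \<le> w \<bullet> x)"

definition feasible_P2 ::
    "real^'m^'m \<Rightarrow> ('n::finite \<Rightarrow> real^'m^'m) \<Rightarrow> real^'n \<Rightarrow> real^'n \<Rightarrow> real^'n \<Rightarrow> real \<Rightarrow> bool" where
  "feasible_P2 A0 A v d x t \<longleftrightarrow> psd (pencil A0 A x) \<and> x - v - t *\<^sub>R d = 0"

definition solves_P2 ::
    "real^'m^'m \<Rightarrow> ('n::finite \<Rightarrow> real^'m^'m) \<Rightarrow> real^'n \<Rightarrow> real^'n \<Rightarrow> real^'n \<Rightarrow> real \<Rightarrow> bool" where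
  "solves_P2 A0 A v d x t \<longleftrightarrow>
     feasible_P2 A0 A v d x t \<and> (\<forall>x' t'. feasible_P2 A0 A v d x' t' \<longrightarrow> t \<le> t')"

definition feasible_D2 ::
    "('n::finite \<Rightarrow> real^'m^'m) \<Rightarrow> (real^'n) set \<Rightarrow> real^'n \<Rightarrow> real^'m^'m \<Rightarrow> real^'n \<Rightarrow> bool" where
  "feasible_D2 A B d U w \<longleftrightarrow>
     w \<in> span B \<and> (\<forall>b\<in>B. mat_inner (linear_pencil A b) U = w \<bullet> b) \<and> d \<bullet> w = 1 \<and> psd U"

definition solves_D2 ::
    "real^'m^'m \<Rightarrow> ('n::finite \<Rightarrow> real^'m^'m) \<Rightarrow> (real^'n) set \<Rightarrow>
     real^'n \<Rightarrow> real^'n \<Rightarrow> real^'m^'m \<Rightarrow> real^'n \<Rightarrow> bool" where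
  "solves_D2 A0 A B v d U w \<longleftrightarrow>
     feasible_D2 A B d U w \<and>
     (\<forall>U' w'. feasible_D2 A B d U' w' \<longrightarrow>
        - mat_inner (pencil A0 A v) U' \<le> - mat_inner (pencil A0 A v) U)"

text \<open>
  The centre is meant to be an interior point of C (relative to the ambient space) and to be the
  average a of the solutions of the initial linear problems. That average can lie on the boundary of
  C, e.g. when all these solutions lie on one edge; only then is another interior point taken.
\<close>

definition admissible_centre :: "'a::euclidean_space set \<Rightarrow> 'a \<Rightarrow> 'a \<Rightarrow> bool" where
  "admissible_centre C a c \<longleftrightarrow> c \<in> rel_interior C \<and> (a \<in> rel_interior C \<longrightarrow> c = a)"

definition initial_directions :: "'a::real_vector set \<Rightarrow> 'a set" where
  "initial_directions B = insert (- (\<Sum>b\<in>B. b)) B"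

text \<open>
  In \<open>Cutting P c \<kappa>\<close>, P is the current outer approximation, c the centre, and \<open>\<kappa>\<close> the
  current error bound. \<open>Cut_Output V\<close> is a final state; it carries the V-representation of
  \<open>convex hull V\<close>.
\<close>

datatype 'a cutting_state =
    Cut_Start
  | Cutting "'a set" 'a ereal
  | Cut_Output "'a set"

text \<open>
  All choices among several solutions of a subproblem are left open, hence a transition relation.
\<close>

inductive cutting_step ::
    "real^'m^'m \<Rightarrow> ('n::finite \<Rightarrow> real^'m^'m) \<Rightarrow> (real^'n) set \<Rightarrow> (real^'n) set \<Rightarrow> real \<Rightarrow>
     (real^'n) cutting_state \<Rightarrow> (real^'n) cutting_state \<Rightarrow> bool"
  for A0 A L B \<epsilon>
where
  init:
    "\<lbrakk> \<forall>w \<in> initial_directions B. solves_P1 (L \<inter> spectrahedron A0 A) w (X w);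
       P = {x \<in> L. \<forall>w \<in> initial_directions B. w \<bullet> x \<le> w \<bullet> X w};
       admissible_centre (L \<inter> spectrahedron A0 A)
         ((1 / (real (card B) + 1)) *\<^sub>R (\<Sum>w \<in> initial_directions B. X w)) c \<rbrakk>
     \<Longrightarrow> cutting_step A0 A L B \<epsilon> Cut_Start (Cutting P c \<infinity>)"
| cut:
    "\<lbrakk> \<kappa> > ereal \<epsilon>;
       finite (ext P);
       \<forall>v \<in> ext P. solves_P2 A0 A v (c - v) (X v) (T v) \<and> solves_D2 A0 A B v (c - v) (U v) (W v);
       vb \<in> ext P;
       \<forall>v \<in> ext P. T v * norm (c - v) \<le> T vb * norm (c - vb) \<rbrakk>
     \<Longrightarrow> cutting_step A0 A L B \<epsilon> (Cutting P c \<kappa>)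
           (Cutting (P \<inter> {x. W vb \<bullet> x \<ge> W vb \<bullet> vb + T vb}) c (ereal (T vb * norm (c - vb))))"
| stop:
    "\<lbrakk> \<not> \<kappa> > ereal \<epsilon>; finite (ext P) \<rbrakk>
     \<Longrightarrow> cutting_step A0 A L B \<epsilon> (Cutting P c \<kappa>) (Cut_Output (ext P))"


section \<open>The approximation algorithm for unbounded spectrahedra\<close>

definition trace_direction :: "('n::finite \<Rightarrow> real^'m^'m) \<Rightarrow> real^'n" where
  "trace_direction A =
     (let u = (\<chi> i. - mat_inner (A i) (mat 1)) in (1 / norm u) *\<^sub>R u)"

definition cone_base ::
    "real^'m^'m \<Rightarrow> ('n::finite \<Rightarrow> real^'m^'m) \<Rightarrow> real \<Rightarrow> (real^'n) set" where
  "cone_base A0 A \<delta> =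
     recession_cone (spectrahedron A0 A) \<inter> {x. trace_direction A \<bullet> x = - (1 + \<delta>)}"

text \<open>
  The truncation of C is the spectrahedron of the pencil obtained by appending the linear
  inequality as a further diagonal entry, indexed by \<open>None\<close>.
\<close>

definition append_diag :: "real^'m^'m \<Rightarrow> real \<Rightarrow> real^('m option)^('m option)" where
  "append_diag X r =
     (\<chi> i j. case i of
        None \<Rightarrow> (case j of None \<Rightarrow> r | Some _ \<Rightarrow> 0)
      | Some i' \<Rightarrow> (case j of None \<Rightarrow> 0 | Some j' \<Rightarrow> X $ i' $ j'))"

text \<open>
  The values of w on \<open>convex hull (ext (C + K))\<close>. Extreme points need not form a closed set, so
  their minimum is read as an infimum.
\<close>

definition extreme_values ::
    "real^'m^'m \<Rightarrow> ('n::finite \<Rightarrow> real^'m^'m) \<Rightarrow> (real^'n) set \<Rightarrow> real set" where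
  "extreme_values A0 A K =
     (\<lambda>y. trace_direction A \<bullet> y) ` (convex hull (ext (spectrahedron A0 A + K)))"

definition truncation_level ::
    "real^'m^'m \<Rightarrow> ('n::finite \<Rightarrow> real^'m^'m) \<Rightarrow> real \<Rightarrow> (real^'n) set \<Rightarrow> real" where
  "truncation_level A0 A \<epsilon> K = Inf (extreme_values A0 A K) - \<epsilon>"

definition trunc_const ::
    "real^'m^'m \<Rightarrow> ('n::finite \<Rightarrow> real^'m^'m) \<Rightarrow> real \<Rightarrow> (real^'n) set \<Rightarrow>
     real^('m option)^('m option)" where
  "trunc_const A0 A \<epsilon> K = append_diag A0 (- truncation_level A0 A \<epsilon> K)"

definition trunc_coeff ::
    "('n::finite \<Rightarrow> real^'m^'m) \<Rightarrow> 'n \<Rightarrow> real^('m option)^('m option)" where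
  "trunc_coeff A i = append_diag (A i) (trace_direction A $ i)"

lemma pencil_trunc:
  "pencil (trunc_const A0 A \<epsilon> K) (trunc_coeff A) x =
     append_diag (pencil A0 A x) (trace_direction A \<bullet> x - truncation_level A0 A \<epsilon> K)"
  by (simp add: vec_eq_iff pencil_def linear_pencil_def trunc_const_def trunc_coeff_def
      append_diag_def inner_vec_def mult.commute split: option.split)

text \<open>
  \<open>Approx_Base B s\<close> and \<open>Approx_Trunc K s\<close> are the states in which the cutting scheme is
  running, with its own state s, on the base M of the recession cone and on the truncation of C.
  \<open>Have_Base Q\<close> holds the approximation Q of M, and \<open>Returned V D\<close> the V-representation of
  the output.
\<close>

datatype 'a alg_state =
    Start
  | Approx_Base "'a set" "'a cutting_state"
  | Have_Base "'a set"
  | Approx_Trunc "'a set" "'a cutting_state"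
  | Returned "'a set" "'a set"

text \<open>
  If M is a single point, its affine hull has dimension 0 and there is nothing to approximate
  (the cutting scheme would face \<open>d = 0\<close>, for which its subproblems have no solution); M is
  then its own approximation.
\<close>

inductive alg_step ::
    "real^'m^'m \<Rightarrow> ('n::finite \<Rightarrow> real^'m^'m) \<Rightarrow> real \<Rightarrow> real \<Rightarrow>
     (real^'n) alg_state \<Rightarrow> (real^'n) alg_state \<Rightarrow> bool"
  for A0 A \<epsilon> \<delta>
where
  base_point:
    "cone_base A0 A \<delta> = {p} \<Longrightarrow> alg_step A0 A \<epsilon> \<delta> Start (Have_Base {p})"
| base_start:
    "\<lbrakk> \<nexists>p. cone_base A0 A \<delta> = {p};
       orthonormal_frame (affine hull (cone_base A0 A \<delta>)) B \<rbrakk>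
     \<Longrightarrow> alg_step A0 A \<epsilon> \<delta> Start (Approx_Base B Cut_Start)"
| base_run:
    "cutting_step 0 A (affine hull (cone_base A0 A \<delta>)) B (\<delta> / 2) s s'
     \<Longrightarrow> alg_step A0 A \<epsilon> \<delta> (Approx_Base B s) (Approx_Base B s')"
| base_finish:
    "alg_step A0 A \<epsilon> \<delta> (Approx_Base B (Cut_Output V)) (Have_Base (convex hull V))"
| trunc_start:
    "\<lbrakk> finite (ext (Q + l1_ball (\<delta> / 2)));
       K = convex_cone hull (ext (Q + l1_ball (\<delta> / 2)));
       extreme_values A0 A K \<noteq> {};
       bdd_below (extreme_values A0 A K) \<rbrakk>
     \<Longrightarrow> alg_step A0 A \<epsilon> \<delta> (Have_Base Q) (Approx_Trunc K Cut_Start)"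
| trunc_run:
    "cutting_step (trunc_const A0 A \<epsilon> K) (trunc_coeff A) UNIV Basis \<epsilon> s s'
     \<Longrightarrow> alg_step A0 A \<epsilon> \<delta> (Approx_Trunc K s) (Approx_Trunc K s')"
| finish:
    "\<lbrakk> finite V'; finite D';
       convex hull V' + convex_cone hull D' = convex hull V + K \<rbrakk>
     \<Longrightarrow> alg_step A0 A \<epsilon> \<delta> (Approx_Trunc K (Cut_Output V)) (Returned V' D')"

definition is_returned :: "'a alg_state \<Rightarrow> bool" where
  "is_returned s \<longleftrightarrow> (\<exists>V D. s = Returned V D)"

text \<open>
  Termination of a nondeterministic procedure: no run is infinite, and a run can only come to a halt
  in a final state, i.e. it never gets stuck because some subproblem has no solution.
\<close>

definition terminates :: "('s \<Rightarrow> 's \<Rightarrow> bool) \<Rightarrow> ('s \<Rightarrow> bool) \<Rightarrow> 's \<Rightarrow> bool" where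
  "terminates step final s \<longleftrightarrow>
     (\<nexists>f :: nat \<Rightarrow> 's. f 0 = s \<and> (\<forall>k. step (f k) (f (Suc k)))) \<and>
     (\<forall>s'. step\<^sup>*\<^sup>* s s' \<and> (\<nexists>s''. step s' s'') \<longrightarrow> final s')"

end

theory Submission
  imports Defs
begin

text \<open>
  A run of the cutting scheme is finite because every cut removes a vertex v at depth bounded below
  in terms of the tolerance, while the normals of the cuts are bounded: the centre c is the centre of
  a ball in the spectrahedron, and \<open>w \<bullet> (c - v) = 1\<close> together with validity of the cut bounds w by
  the inverse radius. The removed vertices are thus uniformly separated in a compact set. A run does
  not get stuck because the restriction of the pencil to the line through v and c has an optimal dual
  solution of rank one.

  In the outer algorithm, the functional given by the trace direction is negative on the nonzero
  recession directions. Hence the base of the recession cone and all truncations of C are compact, so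
  that the cutting scheme applies to both. Thickening makes the interior of K contain the nonzero
  recession directions of C; therefore the extreme points of C + K stay in a bounded part of C, and
  the truncation level is well defined.
\<close>

section \<open>Positive semidefinite matrices\<close>

text \<open>Dual attainment is therefore derived on the line alone. Because \<open>c\<close> can be
  moved both ways along it, every kernel vector of the pencil at \<open>c\<close> is also a kernel
  vector of the directional matrix; the kernel splits off, and compactness of the unit sphere in its
  orthogonal complement does the rest. The procedure is nondeterministic and nested. Termination is
  proved through the inductive predicate \<open>converges\<close>, which treats infinite runs and
  dead ends together and can be carried over from an inner run to the outer one.\<close>

lemma symmetric_matrix_inner:
  fixes X :: "real^'m^'m"
  assumes "transpose X = X"
  shows "x \<bullet> (X *v y) = (X *v x) \<bullet> y"
  by (metis assms dot_lmul_matrix transpose_matrix_vector)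

lemma psd_kernel:
  fixes X :: "real^'m^'m"
  assumes "psd X" and "y \<bullet> (X *v y) = 0"
  shows "X *v y = 0"
proof (rule ccontr)
  assume "X *v y \<noteq> 0"
  define z where "z = X *v y"
  define q where "q = z \<bullet> (X *v z)"
  have sym: "transpose X = X" and nonneg: "\<And>y. 0 \<le> y \<bullet> (X *v y)"
    using assms(1) by (auto simp: psd_def)
  have z: "z \<bullet> z > 0" using \<open>X *v y \<noteq> 0\<close> by (simp add: z_def)
  have q: "q \<ge> 0" using nonneg by (simp add: q_def)
  have expand: "(y + s *\<^sub>R z) \<bullet> (X *v (y + s *\<^sub>R z)) = 2 * s * (z \<bullet> z) + s * s * q" for s
    using assms(2) symmetric_matrix_inner[OF sym, of y z]
    by (simp add: matrix_vector_right_distrib inner_add_left inner_add_right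
        matrix_vector_mult_scaleR flip: z_def q_def) (simp add: algebra_simps)
  \<comment> \<open>A small negative step, because the form along this line has slope
    \<open>2 * (z \<bullet> z)\<close> at 0. The 1 keeps the denominator positive when
    \<open>q\<close> is 0.\<close>
  define s where "s = - (z \<bullet> z) / (q + 1)"
  have "z \<bullet> z = - s * (q + 1)" using q by (simp add: s_def)
  then have "2 * s * (z \<bullet> z) + s * s * q = s * s * (- q - 2)"
    by (simp only:) (simp add: algebra_simps)
  also have "\<dots> < 0"
    using q z unfolding s_def by (intro mult_pos_neg) (auto simp: mult_neg_neg divide_neg_pos)
  finally show False using nonneg[of "y + s *\<^sub>R z"] expand[of s] by simp
qed

lemma psd_zero: "psd 0"
  by (simp add: psd_def) (simp add: transpose_def vec_eq_iff)

lemma psd_add: "psd X \<Longrightarrow> psd Y \<Longrightarrow> psd (X + Y)"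
  by (auto simp: psd_def transpose_def vec_eq_iff matrix_vector_mult_add_rdistrib inner_add_right)

lemma psd_scaleR: "psd X \<Longrightarrow> 0 \<le> r \<Longrightarrow> psd (r *\<^sub>R X)"
  by (auto simp: psd_def transpose_def vec_eq_iff scaleR_matrix_vector_assoc[symmetric])

lemma tendsto_quadratic_form:
  fixes X :: "'b \<Rightarrow> real^'m^'m"
  assumes "(X \<longlongrightarrow> L) F"
  shows "((\<lambda>k. y \<bullet> (X k *v y)) \<longlongrightarrow> y \<bullet> (L *v y)) F"
  unfolding matrix_vector_mult_def inner_vec_def by (simp, intro tendsto_intros assms)

lemma closed_psd: "closed {X :: real^'m^'m. psd X}"
  unfolding closed_sequential_limits
proof (intro allI impI, elim conjE)
  fix X :: "nat \<Rightarrow> real^'m^'m" and L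
  assume X: "\<forall>k. X k \<in> {X. psd X}" and lim: "X \<longlonglongrightarrow> L"
  have entry: "(\<lambda>k. X k $ i $ j) \<longlonglongrightarrow> L $ i $ j" for i j by (intro tendsto_intros lim)
  have "(\<lambda>k. X k $ i $ j) = (\<lambda>k. X k $ j $ i)" for i j
    using X by (auto simp: psd_def transpose_def vec_eq_iff)
  then have "L $ i $ j = L $ j $ i" for i j
    using entry[of i j] entry[of j i] LIMSEQ_unique by metis
  then have "transpose L = L" by (simp add: transpose_def vec_eq_iff)
  moreover have "0 \<le> y \<bullet> (L *v y)" for y
    using tendsto_quadratic_form[OF lim, of y] X by (intro LIMSEQ_le_const) (auto simp: psd_def)
  ultimately show "L \<in> {X. psd X}" by (simp add: psd_def)
qed

lemma quadratic_form_axis: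
  fixes X :: "real^'m^'m"
  shows "axis i 1 \<bullet> (X *v axis i 1) = X $ i $ i"
  by (simp add: matrix_vector_mult_basis column_def inner_axis')

lemma psd_diag_nonneg: "psd X \<Longrightarrow> 0 \<le> X $ i $ i"
  by (metis psd_def quadratic_form_axis)

lemma psd_diag_zero:
  assumes "psd X" and "X $ i $ i = 0"
  shows "X $ j $ i = 0" "X $ i $ j = 0"
proof -
  have "X *v axis i 1 = 0"
    using psd_kernel[OF assms(1)] assms(2) by (simp add: quadratic_form_axis)
  then show 1: "X $ j $ i = 0"
    by (simp add: matrix_vector_mult_basis column_def vec_eq_iff)
  show "X $ i $ j = 0"
    using 1 assms(1) by (auto simp: psd_def transpose_def vec_eq_iff)
qed

lemma psd_trace_pos:
  assumes "psd X" and "X \<noteq> 0"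
  shows "0 < trace X"
proof (rule ccontr)
  assume "\<not> 0 < trace X"
  moreover have "0 \<le> trace X" using assms(1) by (auto simp: trace_def intro: sum_nonneg psd_diag_nonneg)
  ultimately have "trace X = 0" by simp
  then have "X $ i $ i = 0" for i
    using psd_diag_nonneg[OF assms(1)] by (simp add: trace_def sum_nonneg_eq_0_iff)
  then have "X = 0" by (simp only: vec_eq_iff psd_diag_zero(1)[OF assms(1)] zero_index simp_thms)
  with assms(2) show False by simp
qed

section \<open>The trace inner product and rank-one matrices\<close>

definition outer :: "real^'m \<Rightarrow> real^'m^'m" where
  "outer y = (\<chi> i j. y $ i * y $ j)"

lemma mat_inner_eq_sum: "mat_inner X Y = (\<Sum>i\<in>UNIV. \<Sum>j\<in>UNIV. X $ i $ j * Y $ j $ i)"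
  by (simp add: mat_inner_def trace_def matrix_matrix_mult_def)

lemma mat_inner_add_left: "mat_inner (X + Y) U = mat_inner X U + mat_inner Y U"
  and mat_inner_scaleR_left: "mat_inner (r *\<^sub>R X) U = r * mat_inner X U"
  and mat_inner_add_right: "mat_inner U (X + Y) = mat_inner U X + mat_inner U Y"
  and mat_inner_scaleR_right: "mat_inner U (r *\<^sub>R X) = r * mat_inner U X"
  by (simp_all add: mat_inner_eq_sum algebra_simps sum.distrib sum_distrib_left)

lemma linear_mat_inner_left: "linear (\<lambda>X. mat_inner X U)"
  by (simp add: linear_iff mat_inner_add_left mat_inner_scaleR_left)

lemma mat_inner_outer: "mat_inner X (outer y) = y \<bullet> (X *v y)"
  by (simp add: mat_inner_eq_sum outer_def inner_vec_def matrix_vector_mult_def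
      sum_distrib_left mult_ac)

lemma outer_mult_vec: "outer y *v z = (y \<bullet> z) *\<^sub>R y"
  by (simp add: outer_def vec_eq_iff matrix_vector_mult_def inner_vec_def sum_distrib_left sum_distrib_right mult_ac)

lemma psd_outer: "psd (outer y)"
  by (simp add: psd_def outer_mult_vec inner_commute)
     (simp add: outer_def transpose_def vec_eq_iff mult.commute)

text \<open>A pivot step of the Cholesky decomposition splits off a rank-one summand of the second
  matrix.\<close>

lemma psd_mat_inner_nonneg:
  fixes X U :: "real^'m^'m"
  assumes "psd X" and "psd U"
  shows "0 \<le> mat_inner X U"
  using assms(2)
proof (induction "card {i. U $ i $ i \<noteq> 0}" arbitrary: U rule: less_induct)
  case less
  show ?case
  proof (cases "\<exists>i. U $ i $ i \<noteq> 0")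
    case False
    then have "U $ i $ i = 0" for i by blast
    then have "U = 0" by (simp only: vec_eq_iff psd_diag_zero(1)[OF less.prems] zero_index simp_thms)
    then show ?thesis by (simp add: mat_inner_eq_sum)
  next
    case True
    then obtain i where i: "U $ i $ i > 0" using psd_diag_nonneg[OF less.prems] by (metis less_eq_real_def)
    define a where "a = U $ i $ i"
    define y where "y = U *v axis i 1"
    define V where "V = U - (1 / a) *\<^sub>R outer y"
    have sym: "transpose U = U" and nonneg: "\<And>y. 0 \<le> y \<bullet> (U *v y)"
      using less.prems by (auto simp: psd_def)
    have a: "a > 0" using i by (simp add: a_def)
    have y: "y $ j = U $ j $ i" for j
      by (simp add: y_def matrix_vector_mult_basis column_def)
    have V_entry: "V $ j $ k = U $ j $ k - U $ j $ i * U $ k $ i / a" for j k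
      by (simp add: V_def outer_def y)
    have U_sym: "U $ j $ k = U $ k $ j" for j k
      using sym by (auto simp: transpose_def vec_eq_iff)
    have "psd V" unfolding psd_def
    proof (intro conjI allI)
      show "transpose V = V"
        using U_sym by (simp add: transpose_def vec_eq_iff V_entry mult.commute)
      fix z
      \<comment> \<open>This \<open>s\<close> minimises the form of \<open>U\<close> on the line
        through \<open>z\<close> in the direction \<open>axis i 1\<close>; the minimum is the form
        of the Schur complement \<open>V\<close> at \<open>z\<close>.\<close>
      define s where "s = - (y \<bullet> z) / a"
      have "axis i 1 \<bullet> (U *v z) = y \<bullet> z" "axis i 1 \<bullet> y = a"
        using symmetric_matrix_inner[OF sym, of "axis i 1" z]
        by (auto simp: y_def a_def quadratic_form_axis)
      then have "(z + s *\<^sub>R axis i 1) \<bullet> (U *v (z + s *\<^sub>R axis i 1))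
          = z \<bullet> (U *v z) + 2 * s * (y \<bullet> z) + s * s * a"
        by (simp add: matrix_vector_right_distrib inner_add_left inner_add_right
            matrix_vector_mult_scaleR flip: y_def) (simp add: inner_commute algebra_simps)
      also have "\<dots> = z \<bullet> (U *v z) - (y \<bullet> z) * (y \<bullet> z) / a"
        using a by (simp add: s_def field_simps)
      also have "\<dots> = z \<bullet> (V *v z)"
        by (simp add: V_def matrix_vector_mult_diff_rdistrib inner_diff_right outer_mult_vec
            scaleR_matrix_vector_assoc[symmetric] inner_commute)
      finally show "0 \<le> z \<bullet> (V *v z)" using nonneg by metis
    qed
    have "V $ i $ i = 0" using a by (simp add: V_entry a_def)
    \<comment> \<open>A zero diagonal entry of \<open>U\<close> forces its row and column to vanish,
      so the pivot step creates no new nonzero diagonal entry and the induction measure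
      drops.\<close>
    moreover have "V $ j $ j = 0" if "U $ j $ j = 0" for j
      using psd_diag_zero(1)[OF less.prems that, of i] psd_diag_zero(2)[OF less.prems that, of i] that
      by (simp add: V_entry)
    moreover have "U $ i $ i \<noteq> 0" using i by simp
    ultimately have "{j. V $ j $ j \<noteq> 0} \<subset> {j. U $ j $ j \<noteq> 0}" by blast
    then have "card {j. V $ j $ j \<noteq> 0} < card {j. U $ j $ j \<noteq> 0}"
      by (intro psubset_card_mono finite)
    then have "0 \<le> mat_inner X V" by (rule less.hyps[OF _ \<open>psd V\<close>])
    moreover have "mat_inner X U = mat_inner X V + (1 / a) * (y \<bullet> (X *v y))"
    proof -
      have "U = V + (1 / a) *\<^sub>R outer y" by (simp add: V_def)
      then show ?thesis by (metis mat_inner_add_right mat_inner_scaleR_right mat_inner_outer)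
    qed
    moreover have "0 \<le> y \<bullet> (X *v y)" using assms(1) by (simp add: psd_def)
    ultimately show ?thesis using a by simp
  qed
qed

section \<open>Spectrahedra and their recession cones\<close>

lemma linear_linear_pencil: "linear (linear_pencil A)"
  by (simp add: linear_iff linear_pencil_def scaleR_left_distrib sum.distrib scaleR_sum_right)

lemma pencil_add: "pencil A0 A (x + y) = pencil A0 A x + linear_pencil A y"
  by (simp add: pencil_def linear_add[OF linear_linear_pencil])

lemma pencil_add_scaleR: "pencil A0 A (x + t *\<^sub>R d) = pencil A0 A x + t *\<^sub>R linear_pencil A d"
  by (simp add: pencil_add linear_scale[OF linear_linear_pencil])

lemma transpose_linear_pencil:
  "(\<And>i. transpose (A i) = A i) \<Longrightarrow> transpose (linear_pencil A x) = linear_pencil A x"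
  by (simp add: transpose_def vec_eq_iff linear_pencil_def)

lemma psd_convex_combination:
  "psd X \<Longrightarrow> psd Y \<Longrightarrow> 0 \<le> u \<Longrightarrow> 0 \<le> v \<Longrightarrow> psd (u *\<^sub>R X + v *\<^sub>R Y)"
  by (intro psd_add psd_scaleR)

lemma continuous_on_pencil: "continuous_on S (pencil A0 A)"
  unfolding pencil_def[abs_def]
  by (intro continuous_intros linear_continuous_on)
     (simp add: linear_linear_pencil flip: linear_conv_bounded_linear)

lemma closed_spectrahedron: "closed (spectrahedron A0 A)"
proof -
  have "spectrahedron A0 A = pencil A0 A -` {X. psd X}" by (auto simp: spectrahedron_def)
  then show ?thesis
    using continuous_closed_vimage[OF closed_psd, of "pencil A0 A"] continuous_on_pencil[of UNIV A0 A]
    by (simp add: continuous_on_eq_continuous_at)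
qed

lemma convex_spectrahedron: "convex (spectrahedron A0 A)"
proof (rule convexI)
  fix x y and u v :: real
  assume *: "x \<in> spectrahedron A0 A" "y \<in> spectrahedron A0 A" "0 \<le> u" "0 \<le> v" "u + v = 1"
  have "pencil A0 A (u *\<^sub>R x + v *\<^sub>R y) = u *\<^sub>R pencil A0 A x + v *\<^sub>R pencil A0 A y"
    using *(5) by (simp add: pencil_def linear_add[OF linear_linear_pencil]
        linear_scale[OF linear_linear_pencil] scaleR_right_distrib flip: scaleR_left_distrib)
  then show "u *\<^sub>R x + v *\<^sub>R y \<in> spectrahedron A0 A"
    using * by (auto simp: spectrahedron_def intro!: psd_convex_combination)
qed

text \<open>Division by \<open>r k\<close> makes the contribution of \<open>A0\<close> vanish in the
  limit, and positive semidefiniteness survives scaling and limits. This turns unbounded sequences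
  in a spectrahedron into recession directions.\<close>

lemma psd_linear_pencil_limit:
  assumes "\<And>k. psd (pencil A0 A (x k))" and "filterlim r at_top sequentially"
    and "(\<lambda>k. x k /\<^sub>R r k) \<longlonglongrightarrow> d"
  shows "psd (linear_pencil A d)"
proof -
  have "((\<lambda>x. linear_pencil A x) \<longlongrightarrow> linear_pencil A d) (at d)"
    using linear_continuous_at[of "linear_pencil A" d] linear_linear_pencil[of A]
    by (simp add: isCont_def linear_conv_bounded_linear)
  then have "(\<lambda>k. linear_pencil A (x k /\<^sub>R r k)) \<longlonglongrightarrow> linear_pencil A d"
    using assms(3) isContD isCont_tendsto_compose[of d "linear_pencil A"] by (simp add: isCont_def)
  moreover have "(\<lambda>k. A0 /\<^sub>R r k) \<longlonglongrightarrow> 0 *\<^sub>R A0"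
    by (intro tendsto_intros tendsto_inverse_0_at_top assms(2))
  ultimately have "(\<lambda>k. linear_pencil A (x k /\<^sub>R r k) + A0 /\<^sub>R r k) \<longlonglongrightarrow> linear_pencil A d + 0 *\<^sub>R A0"
    by (rule tendsto_add)
  then have lim: "(\<lambda>k. pencil A0 A (x k) /\<^sub>R r k) \<longlonglongrightarrow> linear_pencil A d"
    by (simp add: pencil_def linear_scale[OF linear_linear_pencil] scaleR_right_distrib)
  have "eventually (\<lambda>k. r k \<ge> 0) sequentially"
    using assms(2) by (simp add: filterlim_at_top)
  then have "eventually (\<lambda>k. pencil A0 A (x k) /\<^sub>R r k \<in> {X. psd X}) sequentially"
    by eventually_elim (auto intro: psd_scaleR assms(1))
  from Lim_in_closed_set[OF closed_psd this _ lim] show ?thesis by simp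
qed

lemma recession_cone_spectrahedron:
  assumes "spectrahedron A0 A \<noteq> {}"
  shows "recession_cone (spectrahedron A0 A) = {d. psd (linear_pencil A d)}"
proof (intro equalityI subsetI CollectI)
  fix d assume d: "d \<in> recession_cone (spectrahedron A0 A)"
  obtain z where z: "z \<in> spectrahedron A0 A" using assms by blast
  have "psd (pencil A0 A (z + real k *\<^sub>R d))" for k
    using d z by (simp add: recession_cone_def spectrahedron_def)
  moreover have "(\<lambda>k. (z + real k *\<^sub>R d) /\<^sub>R real k) \<longlonglongrightarrow> d"
  proof -
    have "(\<lambda>k. inverse (real k) *\<^sub>R z + d) \<longlonglongrightarrow> 0 *\<^sub>R z + d"
      by (intro tendsto_intros tendsto_inverse_0_at_top filterlim_real_sequentially)
    moreover have "eventually (\<lambda>k. inverse (real k) *\<^sub>R z + d = (z + real k *\<^sub>R d) /\<^sub>R real k) sequentially"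
      using eventually_gt_at_top[of 0] by eventually_elim (simp add: scaleR_right_distrib)
    ultimately show ?thesis by (simp add: tendsto_cong)
  qed
  ultimately show "psd (linear_pencil A d)"
    by (rule psd_linear_pencil_limit[OF _ filterlim_real_sequentially])
next
  fix d assume "d \<in> {d. psd (linear_pencil A d)}"
  then show "d \<in> recession_cone (spectrahedron A0 A)"
    by (auto simp: recession_cone_def spectrahedron_def pencil_add_scaleR intro: psd_add psd_scaleR)
qed

text \<open>The subset \<open>S\<close> is kept general because the lemma is applied to a slice of
  the spectrahedron, to the whole of it and to a set of extreme points.\<close>

lemma unbounded_spectrahedron_direction:
  fixes A :: "'n::finite \<Rightarrow> real^'m^'m"
  assumes "S \<subseteq> spectrahedron A0 A" and "\<not> bounded S"
  obtains x d where "\<And>k :: nat. x k \<in> S" and "filterlim (\<lambda>k. norm (x k)) at_top sequentially"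
    and "(\<lambda>k. x k /\<^sub>R norm (x k)) \<longlonglongrightarrow> d" and "norm d = 1" and "psd (linear_pencil A d)"
proof -
  have "\<exists>x\<in>S. real k + 1 < norm x" for k
    using assms(2) by (meson bounded_iff not_less)
  then obtain x where x: "\<And>k. x k \<in> S" "\<And>k. real k + 1 < norm (x k)" by metis
  have norm: "norm (x k /\<^sub>R norm (x k)) = 1" for k
    using x(2)[of k] by (cases "x k = 0") auto
  define u where "u k = x k /\<^sub>R norm (x k)" for k
  have "\<forall>k. u k \<in> sphere 0 1" using norm by (simp add: u_def)
  moreover have "compact (sphere (0 :: real^'n) 1)" by simp
  ultimately obtain d r where d: "d \<in> sphere 0 1" "strict_mono r" "(u \<circ> r) \<longlonglongrightarrow> d"
    unfolding compact_def by metis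
  have top: "filterlim (\<lambda>k. norm (x (r k))) at_top sequentially"
  proof (rule filterlim_at_top_mono[OF filterlim_real_sequentially], rule always_eventually, rule allI)
    fix k show "real k \<le> norm (x (r k))"
      using x(2)[of "r k"] seq_suble[OF d(2), of k] by linarith
  qed
  have lim: "(\<lambda>k. x (r k) /\<^sub>R norm (x (r k))) \<longlonglongrightarrow> d" using d(3) by (simp add: o_def u_def)
  have "psd (linear_pencil A d)"
    using psd_linear_pencil_limit[OF _ top lim] x(1) assms(1) by (auto simp: spectrahedron_def)
  with that[of "x \<circ> r" d] x(1) top lim d(1) show thesis by simp
qed

section \<open>The trace direction and compact slices\<close>

lemma mat_inner_mat_1: "mat_inner X (mat 1) = trace X"
  by (simp add: mat_inner_def)

lemma trace_linear_pencil: "trace (linear_pencil A x) = (\<Sum>i\<in>UNIV. x $ i * trace (A i))"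
  by (simp add: linear_pencil_def mat_inner_mat_1[symmetric] linear_sum[OF linear_mat_inner_left]
      mat_inner_scaleR_left)

text \<open>Before normalisation the pairing with \<open>d\<close> is minus the trace of
  \<open>linear_pencil A d\<close>, which is nonzero and positive semidefinite by the
  assumptions.\<close>

lemma trace_direction_neg:
  assumes "\<And>d. linear_pencil A d = 0 \<Longrightarrow> d = 0" and "psd (linear_pencil A d)" and "d \<noteq> 0"
  shows "trace_direction A \<bullet> d < 0"
proof -
  define u where "u = (\<chi> i. - mat_inner (A i) (mat 1))"
  have ud: "u \<bullet> d = - trace (linear_pencil A d)"
    by (simp add: u_def mat_inner_mat_1 trace_linear_pencil inner_vec_def sum_negf mult.commute)
  also have "\<dots> < 0" using psd_trace_pos assms by fastforce
  finally have neg: "u \<bullet> d < 0" .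
  \<comment> \<open>The strict inequality also shows that the normalisation does not divide by
    0.\<close>
  then have "u \<noteq> 0" by auto
  have "trace_direction A \<bullet> d = (u \<bullet> d) / norm u"
    by (simp add: trace_direction_def u_def Let_def)
  with neg \<open>u \<noteq> 0\<close> show ?thesis by (simp add: divide_neg_pos)
qed

text \<open>Only an inequality: without hypotheses on \<open>A\<close> the vector of traces may
  vanish, and the quotient is then 0.\<close>

lemma norm_trace_direction_le: "norm (trace_direction A) \<le> 1"
  by (simp add: trace_direction_def Let_def)

text \<open>An unbounded slice has a limiting recession direction \<open>d\<close>. Dividing the
  constraint by the norms replaces the level \<open>s\<close> by 0 and contradicts
  \<open>trace_direction_neg\<close>. As \<open>A0\<close> is arbitrary, this serves both
  \<open>C\<close> and the homogeneous pencil of its recession cone.\<close>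

lemma compact_spectrahedron_slice:
  assumes "\<And>d. linear_pencil A d = 0 \<Longrightarrow> d = 0"
  shows "compact (spectrahedron A0 A \<inter> {x. s \<le> trace_direction A \<bullet> x})" (is "compact ?S")
  unfolding compact_eq_bounded_closed
proof
  show "closed ?S" by (intro closed_Int closed_spectrahedron closed_halfspace_ge)
  show "bounded ?S"
  proof (rule ccontr)
    assume "\<not> bounded ?S"
    then obtain x d where x: "\<And>k :: nat. x k \<in> ?S" "filterlim (\<lambda>k. norm (x k)) at_top sequentially"
      "(\<lambda>k. x k /\<^sub>R norm (x k)) \<longlonglongrightarrow> d" "norm d = 1" "psd (linear_pencil A d)"
      by (rule unbounded_spectrahedron_direction[OF Int_lower1]) blast
    have "(\<lambda>k. trace_direction A \<bullet> (x k /\<^sub>R norm (x k))) \<longlonglongrightarrow> trace_direction A \<bullet> d"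
      by (intro tendsto_intros x(3))
    moreover have "(\<lambda>k. inverse (norm (x k)) * s) \<longlonglongrightarrow> 0 * s"
      by (intro tendsto_intros tendsto_inverse_0_at_top x(2))
    moreover have "inverse (norm (x k)) * s \<le> trace_direction A \<bullet> (x k /\<^sub>R norm (x k))" for k
      using x(1)[of k] by (simp add: mult_left_mono)
    ultimately have "0 * s \<le> trace_direction A \<bullet> d" by (blast intro: LIMSEQ_le)
    moreover have "trace_direction A \<bullet> d < 0"
      using x(4,5) by (intro trace_direction_neg assms) auto
    ultimately show False by simp
  qed
qed

text \<open>The rank-one matrix of the vector y below is an optimal dual solution. It arises as a limit of
  vectors that certify the infeasibility of the values beyond the optimum; these are taken orthogonal
  to the kernel of G, where the quadratic form of G is definite.\<close>

lemma psd_line_dual: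
  fixes G D :: "real^'m^'m"
  assumes D: "transpose D = D" and \<sigma>: "\<sigma> > 0" "psd (G + \<sigma> *\<^sub>R D)" "psd (G - \<sigma> *\<^sub>R D)"
    and \<tau>: "psd (G - \<tau> *\<^sub>R D)" "\<And>\<tau>'. psd (G - \<tau>' *\<^sub>R D) \<Longrightarrow> \<tau>' \<le> \<tau>"
  obtains y where "y \<bullet> (D *v y) = 1" and "y \<bullet> (G *v y) = \<tau>"
proof -
  have "\<tau> > 0" using \<sigma> \<tau>(2) by force
  have "psd ((1/2) *\<^sub>R (G + \<sigma> *\<^sub>R D) + (1/2) *\<^sub>R (G - \<sigma> *\<^sub>R D))"
    using \<sigma> by (intro psd_convex_combination) auto
  moreover have "(1/2) *\<^sub>R (G + \<sigma> *\<^sub>R D) + (1/2) *\<^sub>R (G - \<sigma> *\<^sub>R D) = G"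
    by (simp add: vec_eq_iff field_simps)
  ultimately have G: "psd G" by simp
  define N where "N = {y. G *v y = 0}"
  have N: "subspace N"
    by (auto simp: N_def subspace_def matrix_vector_right_distrib matrix_vector_mult_scaleR)
  have mult: "(G + s *\<^sub>R D) *v y = G *v y + s *\<^sub>R (D *v y)"
    "(G - s *\<^sub>R D) *v y = G *v y - s *\<^sub>R (D *v y)" for s y
    by (simp_all add: matrix_vector_mult_add_rdistrib matrix_vector_mult_diff_rdistrib
        scaleR_matrix_vector_assoc)
  \<comment> \<open>On a kernel vector of \<open>G\<close> the forms of
    \<open>G + \<sigma> *\<^sub>R D\<close> and \<open>G - \<sigma> *\<^sub>R D\<close> are opposite
    and nonnegative, hence zero, and \<open>psd_kernel\<close> applies. So \<open>N\<close>
    contributes nothing to any form \<open>G - s *\<^sub>R D\<close>.\<close>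
  have DN: "D *v y = 0" if "y \<in> N" for y
  proof -
    have Gy: "G *v y = 0" using that by (simp add: N_def)
    have "0 \<le> y \<bullet> ((G + \<sigma> *\<^sub>R D) *v y)" "0 \<le> y \<bullet> ((G - \<sigma> *\<^sub>R D) *v y)"
      using \<sigma> by (simp_all add: psd_def)
    then have "\<sigma> * (y \<bullet> (D *v y)) = 0" by (simp add: mult Gy)
    then have "y \<bullet> ((G + \<sigma> *\<^sub>R D) *v y) = 0" by (simp add: mult Gy)
    from psd_kernel[OF \<sigma>(2) this] show ?thesis using \<sigma>(1) by (simp add: mult Gy)
  qed
  \<comment> \<open>Values slightly beyond the optimum: maximality of \<open>\<tau>\<close> yields a
    vector on which the form is negative.\<close>
  define \<theta> where "\<theta> k = \<tau> + 1 / real (Suc k)" for k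
  have sym: "transpose (G - s *\<^sub>R D) = G - s *\<^sub>R D" for s
    using G D by (simp add: psd_def transpose_def vec_eq_iff)
  have "\<exists>p. norm p = 1 \<and> p \<in> N\<^sup>\<bottom> \<and> p \<bullet> ((G - \<theta> k *\<^sub>R D) *v p) \<le> 0" for k
  proof -
    let ?F = "G - \<theta> k *\<^sub>R D"
    have "\<not> psd ?F" using \<tau>(2)[of "\<theta> k"] by (auto simp: \<theta>_def)
    then obtain y where y: "y \<bullet> (?F *v y) < 0" using sym by (auto simp: psd_def not_le)
    \<comment> \<open>Only the component orthogonal to \<open>N\<close> matters for the form.
      Staying in the orthogonal complement keeps the limit \<open>q\<close> out of the kernel of
      \<open>G\<close>.\<close>
    obtain a b where ab: "a \<in> N" "\<And>w. w \<in> N \<Longrightarrow> orthogonal b w" "y = a + b"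
      using orthogonal_subspace_decomp_exists[of N y] N by (metis span_eq_iff)
    have Fa: "?F *v a = 0" using ab(1) DN[OF ab(1)] by (simp add: mult N_def)
    then have "y \<bullet> (?F *v y) = b \<bullet> (?F *v b)"
      using symmetric_matrix_inner[OF sym[of "\<theta> k"], of a b]
      by (simp add: ab(3) matrix_vector_right_distrib inner_add_left)
    then have neg: "b \<bullet> (?F *v b) < 0" using y by simp
    then have "b \<noteq> 0" by auto
    define p where "p = b /\<^sub>R norm b"
    have "p \<bullet> (?F *v p) = (b \<bullet> (?F *v b)) * (inverse (norm b) * inverse (norm b))"
      by (simp add: p_def matrix_vector_mult_scaleR)
    also have "\<dots> \<le> 0" using neg by (intro mult_nonpos_nonneg) auto
    finally have "p \<bullet> (?F *v p) \<le> 0" .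
    moreover have "norm p = 1" using \<open>b \<noteq> 0\<close> by (simp add: p_def)
    moreover have "p \<in> N\<^sup>\<bottom>"
      using ab(2) by (auto simp: orthogonal_comp_def p_def orthogonal_def inner_commute)
    ultimately show ?thesis by blast
  qed
  then obtain p where p: "\<And>k. norm (p k) = 1" "\<And>k. p k \<in> N\<^sup>\<bottom>"
      "\<And>k. p k \<bullet> ((G - \<theta> k *\<^sub>R D) *v p k) \<le> 0" by metis
  have "closed (N\<^sup>\<bottom>)" by (simp add: closed_subspace subspace_orthogonal_comp)
  then have "compact (sphere 0 1 \<inter> N\<^sup>\<bottom>)" by (intro compact_Int_closed) auto
  moreover have "\<forall>k. p k \<in> sphere 0 1 \<inter> N\<^sup>\<bottom>" using p by simp
  ultimately obtain q r where q: "q \<in> sphere 0 1 \<inter> N\<^sup>\<bottom>" "strict_mono r" "(p \<circ> r) \<longlonglongrightarrow> q"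
    unfolding compact_def by metis
  have lim_p: "(\<lambda>k. p (r k)) \<longlonglongrightarrow> q" using q(3) by (simp add: o_def)
  have lim_M: "(\<lambda>k. M *v p (r k)) \<longlonglongrightarrow> M *v q" for M :: "real^'m^'m"
    by (rule isCont_tendsto_compose[OF linear_continuous_at lim_p])
       (rule matrix_vector_mul_bounded_linear)
  have "(\<lambda>k. 1 / real (Suc k)) \<longlonglongrightarrow> 0"
    using LIMSEQ_inverse_real_of_nat by (simp add: field_simps)
  then have "\<theta> \<longlonglongrightarrow> \<tau>" using tendsto_add[of "\<lambda>_. \<tau>"] by (force simp: \<theta>_def[abs_def])
  then have lim_\<theta>: "(\<lambda>k. \<theta> (r k)) \<longlonglongrightarrow> \<tau>"
    using LIMSEQ_subseq_LIMSEQ[OF _ q(2)] by (auto simp: o_def)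
  have "(\<lambda>k. p (r k) \<bullet> (G *v p (r k) - \<theta> (r k) *\<^sub>R (D *v p (r k))))
      \<longlonglongrightarrow> q \<bullet> (G *v q - \<tau> *\<^sub>R (D *v q))"
    by (intro tendsto_intros lim_p lim_M lim_\<theta>)
  then have "q \<bullet> (G *v q - \<tau> *\<^sub>R (D *v q)) \<le> 0"
    using p(3) by (intro LIMSEQ_le_const2) (auto simp: mult)
  moreover have "0 \<le> q \<bullet> ((G - \<tau> *\<^sub>R D) *v q)" using \<tau>(1) by (simp add: psd_def)
  \<comment> \<open>The limit of the certificates gives one inequality, feasibility of
    \<open>\<tau>\<close> the other.\<close>
  ultimately have eq: "q \<bullet> (G *v q) = \<tau> * (q \<bullet> (D *v q))" by (simp add: mult inner_diff_right)
  have "q \<bullet> (G *v q) \<noteq> 0"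
  proof
    assume "q \<bullet> (G *v q) = 0"
    then have "q \<in> N" using psd_kernel[OF G] by (simp add: N_def)
    then have "q \<bullet> q = 0" using q(1) by (auto simp: orthogonal_comp_def orthogonal_def)
    then show False using q(1) by simp
  qed
  moreover have "0 \<le> q \<bullet> (G *v q)" using G by (simp add: psd_def)
  ultimately have pos: "q \<bullet> (D *v q) > 0" using eq \<open>\<tau> > 0\<close> by (metis less_eq_real_def zero_less_mult_pos)
  define s where "s = sqrt (q \<bullet> (D *v q))"
  have s: "s > 0" "s * s = q \<bullet> (D *v q)" using pos by (simp_all add: s_def)
  show thesis
    using that[of "q /\<^sub>R s"] s eq pos by (simp add: matrix_vector_mult_scaleR field_simps)
qed

section \<open>Pencils with an appended diagonal entry\<close>

lemma sum_option_UNIV: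
  "(\<Sum>i\<in>UNIV. f i) = f None + (\<Sum>i\<in>UNIV. f (Some i))" for f :: "'a::finite option \<Rightarrow> 'b::comm_monoid_add"
  by (simp add: UNIV_option_conv sum.reindex)

lemma psd_append_diag: "psd (append_diag X r) \<longleftrightarrow> psd X \<and> 0 \<le> r"
proof -
  have quad: "y \<bullet> (append_diag X r *v y) = r * (y $ None)\<^sup>2 + (\<chi> i. y $ Some i) \<bullet> (X *v (\<chi> i. y $ Some i))" for y
    by (simp add: inner_vec_def matrix_vector_mult_def append_diag_def sum_option_UNIV power2_eq_square)
  have sym: "transpose (append_diag X r) = append_diag X r \<longleftrightarrow> transpose X = X"
    by (simp add: transpose_def vec_eq_iff append_diag_def split_option_all)
  show ?thesis
  proof
    assume psd: "psd (append_diag X r)"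
    have "0 \<le> z \<bullet> (X *v z)" for z
      using psd quad[of "\<chi> i. case i of None \<Rightarrow> 0 | Some j \<Rightarrow> z $ j"]
      by (simp add: psd_def) metis
    moreover have "0 \<le> r"
      using psd_diag_nonneg[OF psd, of None] by (simp add: append_diag_def)
    ultimately show "psd X \<and> 0 \<le> r" using psd sym by (simp add: psd_def)
  next
    assume "psd X \<and> 0 \<le> r"
    then show "psd (append_diag X r)" using sym by (simp add: psd_def quad)
  qed
qed

lemma transpose_append_diag: "transpose X = X \<Longrightarrow> transpose (append_diag X r) = append_diag X r"
  by (simp add: transpose_def vec_eq_iff append_diag_def split_option_all)

lemma spectrahedron_trunc:
  "spectrahedron (trunc_const A0 A \<epsilon> K) (trunc_coeff A) =
     spectrahedron A0 A \<inter> {x. truncation_level A0 A \<epsilon> K \<le> trace_direction A \<bullet> x}"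
  by (auto simp: spectrahedron_def pencil_trunc psd_append_diag)

section \<open>Termination of transition relations\<close>

text \<open>Accessibility along \<open>step\<close>, with the absence of dead ends built in. Unlike
  \<open>terminates\<close> it comes with an induction rule, so that phases can be composed.\<close>

inductive converges :: "('s \<Rightarrow> 's \<Rightarrow> bool) \<Rightarrow> ('s \<Rightarrow> bool) \<Rightarrow> 's \<Rightarrow> bool" for step final where
  converges: "final s \<or> (\<exists>s'. step s s') \<Longrightarrow> (\<And>s'. step s s' \<Longrightarrow> converges step final s')
    \<Longrightarrow> converges step final s"

lemma converges_terminates:
  assumes "converges step final s"
  shows "terminates step final s"
  unfolding terminates_def
proof (intro conjI notI allI impI)
  show False if "\<exists>f. f 0 = s \<and> (\<forall>k. step (f k) (f (Suc k)))"
    using assms that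
  proof (induction rule: converges.induct)
    case (converges s)
    then obtain f where f: "f 0 = s" "\<And>k. step (f k) (f (Suc k))" by blast
    have "step s (f 1)" using f(1) f(2)[of 0] by simp
    moreover have "\<exists>g. g 0 = f 1 \<and> (\<forall>k. step (g k) (g (Suc k)))"
      using f(2) by (intro exI[of _ "\<lambda>k. f (Suc k)"]) simp
    ultimately show False by (rule converges.IH)
  qed
  have conv: "converges step final s'" if "step\<^sup>*\<^sup>* s s'" for s'
    using that
  proof (induction rule: rtranclp_induct)
    case (step s' s'')
    show ?case using step.IH by (rule converges.cases) (use step.hyps in blast)
  qed (rule assms)
  fix s' assume s': "step\<^sup>*\<^sup>* s s' \<and> (\<nexists>s''. step s' s'')"
  then have "converges step final s'" using conv by blast
  then show "final s'" by (rule converges.cases) (use s' in blast)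
qed

text \<open>By \<open>progress\<close>, a state in \<open>I\<close> that does not converge has a
  successor that does not converge either; dependent choice would then build an infinite
  run.\<close>

lemma converges_if_invariant:
  assumes "I s" and step: "\<And>s s'. I s \<Longrightarrow> step s s' \<Longrightarrow> I s'"
    and progress: "\<And>s. I s \<Longrightarrow> final s \<or> (\<exists>s'. step s s')"
    and chain: "\<nexists>f. f 0 = s \<and> (\<forall>k. I (f k) \<and> step (f k) (f (Suc k)))"
  shows "converges step final s"
proof (rule ccontr)
  assume not_conv: "\<not> converges step final s"
  \<comment> \<open>The clause for \<open>k = 0\<close> fixes the start of the run inside the
    predicate handed to dependent choice.\<close>
  have "\<exists>f. \<forall>k. (I (f k) \<and> \<not> converges step final (f k) \<and> (k = 0 \<longrightarrow> f k = s))
      \<and> step (f k) (f (Suc k))"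
  proof (rule dependent_nat_choice)
    fix t and n :: nat
    assume t: "I t \<and> \<not> converges step final t \<and> (n = 0 \<longrightarrow> t = s)"
    then obtain t' where "step t t'" "\<not> converges step final t'"
      using progress[of t] converges.intros[of final t step] by blast
    then show "\<exists>t'. (I t' \<and> \<not> converges step final t' \<and> (Suc n = 0 \<longrightarrow> t' = s)) \<and> step t t'"
      using step t by blast
  qed (use assms(1) not_conv in blast)
  with chain show False by blast
qed

lemma close_pair_in_compact:
  fixes v :: "nat \<Rightarrow> 'a::metric_space"
  assumes "compact S" and "\<And>k. v k \<in> S" and "\<eta> > 0"
  obtains j k where "j < k" and "dist (v j) (v k) < \<eta>"
proof -
  obtain l r where r: "strict_mono r" "(v \<circ> r) \<longlonglongrightarrow> l"
    using assms(1,2) unfolding compact_def by metis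
  then have "Cauchy (v \<circ> r)" using LIMSEQ_imp_Cauchy by blast
  then obtain N where "\<And>m n. N \<le> m \<Longrightarrow> N \<le> n \<Longrightarrow> dist ((v \<circ> r) m) ((v \<circ> r) n) < \<eta>"
    using assms(3) unfolding Cauchy_def by blast
  then have "dist (v (r N)) (v (r (Suc N))) < \<eta>" by simp
  moreover have "r N < r (Suc N)" using r(1) by (simp add: strict_mono_Suc_iff)
  ultimately show thesis using that by blast
qed

text \<open>The inner procedure runs inside the outer one through \<open>g\<close>: an outer step
  either mirrors an inner step or leaves for a state already known to converge. The premise of
  \<open>succ\<close> restricts it to inner states that are final or can move, and this is how the
  facts recorded in \<open>F\<close> reach the outer procedure.\<close>

lemma converges_embed:
  assumes "converges R F s"
    and step: "\<And>s s'. R s s' \<Longrightarrow> R' (g s) (g s')"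
    and exit: "\<And>s. F s \<Longrightarrow> \<exists>t. R' (g s) t"
    and succ: "\<And>s t. F s \<or> (\<exists>s'. R s s') \<Longrightarrow> R' (g s) t
      \<Longrightarrow> (\<exists>s'. R s s' \<and> t = g s') \<or> converges R' F' t"
  shows "converges R' F' (g s)"
  using assms(1)
proof (induction rule: converges.induct)
  case (converges s)
  show ?case
  proof (rule converges.intros)
    show "F' (g s) \<or> (\<exists>t. R' (g s) t)" using converges.hyps(1) step exit by blast
    show "converges R' F' t" if "R' (g s) t" for t
      using succ[OF converges.hyps(1) that] converges.IH by blast
  qed
qed

section \<open>The cutting scheme\<close>

text \<open>Covers both uses of the scheme, in the affine hull of the base and in the full space. By
  \<open>hull\<close>, relative interior points are interior within \<open>L\<close>;
  \<open>nontrivial\<close> keeps the centre from being a vertex, so that the line of each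
  subproblem has a nonzero direction.\<close>

locale cutting_scheme =
  fixes A0 :: "real^'m^'m" and A :: "'n::finite \<Rightarrow> real^'m^'m" and L B :: "(real^'n) set" and \<epsilon> :: real
  assumes eps: "\<epsilon> > 0"
    and sym: "transpose A0 = A0" "\<And>i. transpose (A i) = A i"
    and compact: "compact (L \<inter> spectrahedron A0 A)"
    and hull: "affine hull (L \<inter> spectrahedron A0 A) = L"
    and nontrivial: "\<And>p. L \<inter> spectrahedron A0 A \<noteq> {p}"
    and frame: "orthonormal_frame L B"
begin

abbreviation "S \<equiv> L \<inter> spectrahedron A0 A"

lemma finite_frame: "finite B"
  using frame pairwise_orthogonal_imp_finite by (auto simp: orthonormal_frame_def)

lemma affine_L: "affine L"
  using affine_affine_hull[of S] hull by simp

lemma diff_in_span: "x \<in> L \<Longrightarrow> y \<in> L \<Longrightarrow> x - y \<in> span B"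
  using frame by (auto simp: orthonormal_frame_def)

lemma add_span_in: "x \<in> L \<Longrightarrow> z \<in> span B \<Longrightarrow> x + s *\<^sub>R z \<in> L"
  using frame mem_affine_3_minus[OF affine_L] by (fastforce simp: orthonormal_frame_def)

lemma frame_inner: "b \<in> B \<Longrightarrow> b' \<in> B \<Longrightarrow> b \<bullet> b' = (if b = b' then 1 else 0)"
  using frame by (auto simp: orthonormal_frame_def pairwise_def orthogonal_def norm_eq_1)

lemma inner_frame_sum: "b \<in> B \<Longrightarrow> (\<Sum>b'\<in>B. f b' *\<^sub>R b') \<bullet> b = f b"
  by (simp add: inner_sum_left frame_inner finite_frame if_distrib sum.delta' cong: if_cong)

lemma frame_expansion:
  assumes "z \<in> span B"
  shows "(\<Sum>b\<in>B. (z \<bullet> b) *\<^sub>R b) = z"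
  using assms
proof (induction rule: span_induct)
  case base
  show ?case
    unfolding subspace_def
    by (auto simp: inner_add_left scaleR_left_distrib sum.distrib simp flip: scaleR_scaleR scaleR_sum_right)
next
  case (step x)
  then have "(\<Sum>b\<in>B. (x \<bullet> b) *\<^sub>R b) = (\<Sum>b\<in>B. if x = b then b else 0)"
    by (intro sum.cong) (auto simp: frame_inner)
  with step show ?case by (simp add: finite_frame)
qed

lemma nonempty: "S \<noteq> {}"
proof
  assume "S = {}"
  then have "L = {}" using hull by simp
  then have "span B = {}" using frame by (simp add: orthonormal_frame_def)
  then show False using span_zero by blast
qed

lemma convex_S: "convex S"
  by (simp add: convex_Int affine_imp_convex affine_L convex_spectrahedron)

lemma rel_interior_ball:
  assumes "c \<in> rel_interior S"
  obtains e where "e > 0" and "\<And>z. z \<in> span B \<Longrightarrow> norm z \<le> e \<Longrightarrow> c + z \<in> S"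
proof -
  obtain e where e: "e > 0" "cball c e \<inter> L \<subseteq> S" and "c \<in> S"
    using assms by (auto simp: mem_rel_interior_cball hull)
  have "c + z \<in> S" if "z \<in> span B" "norm z \<le> e" for z
    using e(2) add_span_in[of c z 1] that \<open>c \<in> S\<close> by (auto simp: dist_norm)
  then show thesis using that e(1) by blast
qed

text \<open>The dual constraints are imposed on the frame only; both sides are linear in
  \<open>z\<close>.\<close>

lemma feasible_D2_inner:
  assumes "feasible_D2 A B d U w" and "z \<in> span B"
  shows "w \<bullet> z = mat_inner (linear_pencil A z) U"
  using assms(2)
proof (induction rule: span_induct)
  case base
  show ?case
    unfolding subspace_def
    by (auto simp: inner_add_right linear_add[OF linear_linear_pencil] mat_inner_add_left
        linear_scale[OF linear_linear_pencil] mat_inner_scaleR_left linear_0[OF linear_linear_pencil]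
        linear_0[OF linear_mat_inner_left])
next
  case (step x)
  then show ?case using assms(1) by (simp add: feasible_D2_def)
qed

lemma D2_weak_duality:
  assumes "feasible_P2 A0 A v d x t" and "feasible_D2 A B d U w" and "d \<in> span B"
  shows "- mat_inner (pencil A0 A v) U \<le> t"
proof -
  have "x = v + t *\<^sub>R d" using assms(1) by (simp add: feasible_P2_def algebra_simps)
  then have "mat_inner (pencil A0 A x) U = mat_inner (pencil A0 A v) U + t"
    using feasible_D2_inner[OF assms(2,3)] assms(2)
    by (simp add: pencil_add_scaleR mat_inner_add_left mat_inner_scaleR_left feasible_D2_def inner_commute)
  moreover have "0 \<le> mat_inner (pencil A0 A x) U"
    using assms by (intro psd_mat_inner_nonneg) (auto simp: feasible_P2_def feasible_D2_def)
  ultimately show ?thesis by simp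
qed

section \<open>Primal and dual solutions on the line through a vertex and the centre\<close>

lemma P2_solvable:
  assumes "v \<in> L" and "c \<in> S" and "v \<noteq> c"
  shows "\<exists>x t. solves_P2 A0 A v (c - v) x t"
proof -
  define T where "T = {t. v + t *\<^sub>R (c - v) \<in> S}"
  have "T = (\<lambda>t. v + t *\<^sub>R (c - v)) -` S" by (auto simp: T_def)
  moreover have "closed ((\<lambda>t. v + t *\<^sub>R (c - v)) -` S)"
    using compact by (intro continuous_closed_vimage compact_imp_closed) (auto intro!: continuous_intros)
  ultimately have "closed T" by simp
  moreover have "bounded T"
  proof -
    obtain M where M: "\<And>x. x \<in> S \<Longrightarrow> norm x \<le> M"
      using compact_imp_bounded[OF compact] by (auto simp: bounded_iff)
    have "norm t \<le> (M + norm v) / norm (c - v)" if "t \<in> T" for t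
    proof -
      have "\<bar>t\<bar> * norm (c - v) = norm (t *\<^sub>R (c - v))" by simp
      also have "\<dots> \<le> norm (v + t *\<^sub>R (c - v)) + norm v"
        by (metis add_diff_cancel_left' norm_triangle_ineq4)
      also have "\<dots> \<le> M + norm v" using M that by (auto simp: T_def)
      finally show ?thesis using assms(3) by (simp add: field_simps)
    qed
    then show ?thesis by (auto simp: bounded_iff)
  qed
  moreover have "1 \<in> T" using assms(2) by (simp add: T_def)
  ultimately obtain t where t: "t \<in> T" "\<And>t'. t' \<in> T \<Longrightarrow> t \<le> t'"
    using compact_attains_inf[of T] by (auto simp: compact_eq_bounded_closed)
  \<comment> \<open>The subproblem does not mention \<open>L\<close>, but the line through
    \<open>v\<close> and \<open>c\<close> stays in \<open>L\<close>.\<close>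
  have T_iff: "t' \<in> T \<longleftrightarrow> feasible_P2 A0 A v (c - v) x t' " if "x = v + t' *\<^sub>R (c - v)" for x t'
    using add_span_in[OF assms(1) diff_in_span[of c v], of t'] assms(1,2) that
    by (simp add: T_def feasible_P2_def spectrahedron_def)
  have "solves_P2 A0 A v (c - v) (v + t *\<^sub>R (c - v)) t"
    unfolding solves_P2_def
  proof (intro conjI allI impI)
    show "feasible_P2 A0 A v (c - v) (v + t *\<^sub>R (c - v)) t" using T_iff t(1) by blast
    fix x t' assume f: "feasible_P2 A0 A v (c - v) x t'"
    then have "x = v + t' *\<^sub>R (c - v)" by (simp add: feasible_P2_def algebra_simps)
    then show "t \<le> t'" using T_iff f t(2) by blast
  qed
  then show ?thesis by blast
qed

text \<open>Measured from \<open>c\<close> towards \<open>v\<close>, the minimal \<open>t\<close>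
  becomes the maximal step \<open>1 - t\<close>, the setting of \<open>psd_line_dual\<close>. The
  resulting rank-one matrix is the dual point.\<close>

lemma D2_strong_duality:
  assumes "v \<in> L" and "c \<in> rel_interior S" and "v \<noteq> c" and P2: "solves_P2 A0 A v (c - v) x t"
  obtains U w where "feasible_D2 A B (c - v) U w" and "- mat_inner (pencil A0 A v) U = t"
proof -
  let ?D = "linear_pencil A (c - v)" and ?G = "pencil A0 A c"
  have "c \<in> L" using assms(2) rel_interior_subset by blast
  then have d: "c - v \<in> span B" using assms(1) by (rule diff_in_span)
  obtain e where e: "e > 0" "\<And>z. z \<in> span B \<Longrightarrow> norm z \<le> e \<Longrightarrow> c + z \<in> S"
    using rel_interior_ball[OF assms(2)] by blast
  \<comment> \<open>Moving by this multiple of \<open>c - v\<close> uses up exactly the radius of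
    the ball.\<close>
  define \<sigma> where "\<sigma> = e / norm (c - v)"
  have \<sigma>: "\<sigma> > 0" using e(1) assms(3) by (simp add: \<sigma>_def)
  have "c + s *\<^sub>R (c - v) \<in> S" if "\<bar>s\<bar> = \<sigma>" for s
    using that assms(3) by (intro e(2) span_scale d) (simp add: \<sigma>_def)
  then have psd_pm: "psd (?G + s *\<^sub>R ?D)" if "\<bar>s\<bar> = \<sigma>" for s
    using that by (simp add: spectrahedron_def pencil_add_scaleR)
  have line: "pencil A0 A (v + s *\<^sub>R (c - v)) = ?G - (1 - s) *\<^sub>R ?D" for s
    using pencil_add[of A0 A v "c - v"] by (simp add: pencil_add_scaleR scaleR_left_diff_distrib)
  have feasible: "feasible_P2 A0 A v (c - v) (v + s *\<^sub>R (c - v)) s \<longleftrightarrow> psd (?G - (1 - s) *\<^sub>R ?D)" for s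
    by (simp add: feasible_P2_def line)
  have x: "x = v + t *\<^sub>R (c - v)"
    using P2 by (simp add: solves_P2_def feasible_P2_def algebra_simps)
  obtain y where y: "y \<bullet> (?D *v y) = 1" "y \<bullet> (?G *v y) = 1 - t"
  proof (rule psd_line_dual[where \<sigma> = \<sigma>])
    show "transpose ?D = ?D" by (intro transpose_linear_pencil sym)
    show "psd (?G + \<sigma> *\<^sub>R ?D)" "psd (?G - \<sigma> *\<^sub>R ?D)"
      using psd_pm[of \<sigma>] psd_pm[of "- \<sigma>"] \<sigma> by simp_all
    show "psd (?G - (1 - t) *\<^sub>R ?D)" using P2 feasible x by (simp add: solves_P2_def)
    show "\<tau>' \<le> 1 - t" if "psd (?G - \<tau>' *\<^sub>R ?D)" for \<tau>'
    proof -
      have "t \<le> 1 - \<tau>'" using P2 feasible[of "1 - \<tau>'"] that by (auto simp: solves_P2_def)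
      then show ?thesis by simp
    qed
  qed (use \<sigma> in auto)
  \<comment> \<open>The frame coordinates of \<open>w\<close> are dictated by the dual
    constraints.\<close>
  define w where "w = (\<Sum>b\<in>B. mat_inner (linear_pencil A b) (outer y) *\<^sub>R b)"
  have w: "w \<in> span B" unfolding w_def by (intro span_sum span_scale span_base)
  have wb: "w \<bullet> b = mat_inner (linear_pencil A b) (outer y)" if "b \<in> B" for b
    using inner_frame_sum[OF that] by (simp add: w_def)
  have "w \<bullet> (c - v) = (\<Sum>b\<in>B. ((c - v) \<bullet> b) * (w \<bullet> b))"
    by (subst frame_expansion[OF d, symmetric]) (simp add: inner_sum_right)
  also have "\<dots> = mat_inner (linear_pencil A (\<Sum>b\<in>B. ((c - v) \<bullet> b) *\<^sub>R b)) (outer y)"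
    by (simp add: wb linear_sum[OF linear_linear_pencil] linear_sum[OF linear_mat_inner_left]
        linear_scale[OF linear_linear_pencil] mat_inner_scaleR_left)
  also have "\<dots> = 1" using y(1) by (simp only: frame_expansion[OF d] mat_inner_outer)
  finally have "feasible_D2 A B (c - v) (outer y) w"
    using w wb by (simp add: feasible_D2_def psd_outer inner_commute)
  moreover have "- mat_inner (pencil A0 A v) (outer y) = t"
    using y line[of 0] by (simp add: mat_inner_outer matrix_vector_mult_diff_rdistrib inner_diff_right)
  ultimately show thesis by (rule that)
qed

lemma D2_solvable:
  assumes "v \<in> L" and "c \<in> rel_interior S" and "v \<noteq> c" and P2: "solves_P2 A0 A v (c - v) x t"
  shows "\<exists>U w. solves_D2 A0 A B v (c - v) U w"
proof -
  obtain U w where Uw: "feasible_D2 A B (c - v) U w" "- mat_inner (pencil A0 A v) U = t"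
    using D2_strong_duality[OF assms] by blast
  have d: "c - v \<in> span B" using assms(1,2) rel_interior_subset by (intro diff_in_span) auto
  have "- mat_inner (pencil A0 A v) U' \<le> t" if "feasible_D2 A B (c - v) U' w'" for U' w'
    using D2_weak_duality[OF _ that d] P2 unfolding solves_P2_def by blast
  with Uw show ?thesis unfolding solves_D2_def by blast
qed

text \<open>Pairing \<open>U\<close> with the pencil at \<open>z\<close> gives a nonnegative number,
  so \<open>w \<bullet> (z - v)\<close> is at least the dual value of \<open>U\<close>. This value
  is at least \<open>t\<close>, because some dual point attains \<open>t\<close>.\<close>

lemma cut_valid:
  assumes "v \<in> L" and "c \<in> rel_interior S" and "v \<noteq> c" and P2: "solves_P2 A0 A v (c - v) x t"
    and D2: "solves_D2 A0 A B v (c - v) U w" and "z \<in> S"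
  shows "w \<bullet> v + t \<le> w \<bullet> z"
proof -
  obtain U' w' where "feasible_D2 A B (c - v) U' w'" "- mat_inner (pencil A0 A v) U' = t"
    using D2_strong_duality[OF assms(1-4)] by blast
  then have t: "t \<le> - mat_inner (pencil A0 A v) U" using D2 by (auto simp: solves_D2_def)
  have feas: "feasible_D2 A B (c - v) U w" using D2 by (simp add: solves_D2_def)
  have "w \<bullet> (z - v) = mat_inner (linear_pencil A (z - v)) U"
    using feasible_D2_inner[OF feas] diff_in_span assms(1,6) by simp
  also have "\<dots> = mat_inner (pencil A0 A z) U - mat_inner (pencil A0 A v) U"
    using pencil_add[of A0 A v "z - v"] by (simp add: mat_inner_add_left)
  also have "\<dots> \<ge> - mat_inner (pencil A0 A v) U"
    using psd_mat_inner_nonneg[of "pencil A0 A z" U] assms(6) feas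
    by (simp add: spectrahedron_def feasible_D2_def)
  finally show ?thesis using t by (simp add: inner_diff_right)
qed

lemma cut_normal_bound:
  assumes "v \<in> L" and "c \<in> rel_interior S" and "v \<noteq> c" and P2: "solves_P2 A0 A v (c - v) x t"
    and D2: "solves_D2 A0 A B v (c - v) U w" and "t > 0"
    and e: "e > 0" "\<And>z. z \<in> span B \<Longrightarrow> norm z \<le> e \<Longrightarrow> c + z \<in> S"
  shows "e * norm w \<le> 1"
proof (cases "w = 0")
  case False
  \<comment> \<open>\<open>c + z\<close> is the point of the ball farthest in the direction
    \<open>- w\<close>; the cut evaluated there leaves
    \<open>e * norm w \<le> 1 - t\<close>.\<close>
  define z where "z = - (e / norm w) *\<^sub>R w"
  have w: "w \<in> span B" "w \<bullet> (c - v) = 1"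
    using D2 by (auto simp: solves_D2_def feasible_D2_def inner_commute)
  have "c + z \<in> S" using w(1) e(1) False by (intro e(2)) (auto simp: z_def span_neg span_scale)
  then have "w \<bullet> v + t \<le> w \<bullet> (c + z)" using cut_valid assms(1-5) by blast
  moreover have "w \<bullet> z = - (e * norm w)"
    by (simp add: z_def power2_norm_eq_inner[symmetric] power2_eq_square)
  ultimately show ?thesis using w(2) \<open>t > 0\<close> by (simp add: inner_add_right inner_diff_right)
qed simp

section \<open>Outer approximations and the invariant of the scheme\<close>

definition outer_approx :: "(real^'n) set \<Rightarrow> (real^'n) \<Rightarrow> bool" where
  "outer_approx P c \<longleftrightarrow> polyhedron P \<and> bounded P \<and> S \<subseteq> P \<and> P \<subseteq> L \<and> c \<in> rel_interior S"

lemma outer_approx_ext: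
  assumes "outer_approx P c"
  shows "finite (ext P)" "convex hull (ext P) = P" "ext P \<noteq> {}" "ext P \<subseteq> L" "c \<notin> ext P"
proof -
  have P: "polyhedron P" "bounded P" "S \<subseteq> P" "P \<subseteq> L" "c \<in> rel_interior S"
    using assms by (auto simp: outer_approx_def)
  have cc: "compact P" "convex P"
    using P(1,2) by (auto simp: compact_eq_bounded_closed polyhedron_imp_closed polyhedron_imp_convex)
  show "finite (ext P)" using finite_polyhedron_extreme_points[OF P(1)] by (simp add: ext_def)
  show hull_ext: "convex hull (ext P) = P" using Krein_Milman_Minkowski[OF cc] by (simp add: ext_def)
  show "ext P \<noteq> {}"
  proof
    assume "ext P = {}"
    then have "P = {}" using hull_ext by simp
    then show False using P(3) nonempty by simp
  qed
  show "ext P \<subseteq> L" using P(4) by (auto simp: ext_def extreme_point_of_def)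
  \<comment> \<open>With equal affine hulls the relative interior of \<open>S\<close> lies in that
    of \<open>P\<close>, so the centre cannot be a vertex.\<close>
  have "affine hull P = L"
  proof
    show "affine hull P \<subseteq> L" using P(4) affine_L by (simp add: hull_minimal)
    show "L \<subseteq> affine hull P" using hull_mono[OF P(3)] hull by metis
  qed
  then have "c \<in> rel_interior P" using rel_interior_mono[OF P(3)] hull P(5) by auto
  moreover have "P \<noteq> {c}" using P(3) nonempty nontrivial by blast
  ultimately show "c \<notin> ext P" using extreme_point_not_in_REL_INTERIOR by (auto simp: ext_def)
qed

lemma initial_outer_approx:
  assumes X: "\<forall>w \<in> initial_directions B. solves_P1 S w (X w)"
    and P: "P = {x \<in> L. \<forall>w \<in> initial_directions B. w \<bullet> x \<le> w \<bullet> X w}"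
    and c: "admissible_centre S a c"
  shows "outer_approx P c"
  unfolding outer_approx_def
proof (intro conjI)
  have fin: "finite (initial_directions B)" by (simp add: initial_directions_def finite_frame)
  have "P = L \<inter> \<Inter>((\<lambda>w. {x. w \<bullet> x \<le> w \<bullet> X w}) ` initial_directions B)" by (auto simp: P)
  then show "polyhedron P"
    using fin affine_imp_polyhedron[OF affine_L]
    by (auto intro!: polyhedron_Int polyhedron_Inter polyhedron_halfspace_le)
  show "S \<subseteq> P" using X by (auto simp: P solves_P1_def)
  show "P \<subseteq> L" by (auto simp: P)
  show "c \<in> rel_interior S" using c by (simp add: admissible_centre_def)
  obtain p where p: "p \<in> L" using nonempty by blast
  define m where "m w = w \<bullet> (X w - p)" for w
  define w0 where "w0 = - (\<Sum>b\<in>B. b)"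
  define M where "M = \<bar>m w0\<bar> + (\<Sum>b\<in>B. \<bar>m b\<bar>)"
  have M: "\<bar>m w0\<bar> \<le> M" "\<And>b. b \<in> B \<Longrightarrow> \<bar>m b\<bar> \<le> M"
    using finite_frame by (auto simp: M_def sum_nonneg intro!: member_le_sum add_increasing)
  have "norm x \<le> norm p + card B * M" if "x \<in> P" for x
  proof -
    define z where "z = x - p"
    have x: "x \<in> L" "\<And>w. w \<in> initial_directions B \<Longrightarrow> w \<bullet> x \<le> w \<bullet> X w" using that by (auto simp: P)
    have up: "w \<bullet> z \<le> m w" if "w \<in> initial_directions B" for w
      using x(2)[OF that] by (simp add: z_def m_def inner_diff_right)
    have b_up: "b \<bullet> z \<le> m b" if "b \<in> B" for b using that up by (simp add: initial_directions_def)
    have w0: "w0 \<bullet> z \<le> m w0" using up[of w0] by (simp add: initial_directions_def w0_def)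
    have "\<bar>b \<bullet> z\<bar> \<le> M" if b: "b \<in> B" for b
    proof -
      \<comment> \<open>The frame directions bound the coordinates only from above. A lower bound
        for one coordinate comes from \<open>w0\<close>, once the upper bounds of the others are
        added.\<close>
      have "- (b \<bullet> z) = w0 \<bullet> z + (\<Sum>b'\<in>B - {b}. b' \<bullet> z)"
        using sum.remove[OF finite_frame b, of "\<lambda>b'. b' \<bullet> z"] by (simp add: w0_def inner_sum_left)
      also have "\<dots> \<le> \<bar>m w0\<bar> + (\<Sum>b'\<in>B - {b}. \<bar>m b'\<bar>)"
        using w0 b_up by (intro add_mono sum_mono) force+
      also have "\<dots> \<le> M"
        unfolding M_def using finite_frame by (intro add_left_mono sum_mono2) auto
      finally show ?thesis using b_up[OF b] M(2)[OF b] by linarith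
    qed
    then have "(\<Sum>b\<in>B. norm ((z \<bullet> b) *\<^sub>R b)) \<le> card B * M"
      using frame by (intro sum_bounded_above) (auto simp: orthonormal_frame_def inner_commute)
    moreover have "z = (\<Sum>b\<in>B. (z \<bullet> b) *\<^sub>R b)"
      using frame_expansion[OF diff_in_span[OF x(1) p]] by (simp add: z_def)
    ultimately have "norm z \<le> card B * M" by (metis norm_sum order_trans)
    moreover have "norm x \<le> norm p + norm z" by (simp add: z_def norm_triangle_sub)
    ultimately show ?thesis by linarith
  qed
  then show "bounded P" by (auto simp: bounded_iff)
qed

lemma cut_outer_approx:
  assumes "outer_approx P c" and "v \<in> ext P"
    and "solves_P2 A0 A v (c - v) x t" and "solves_D2 A0 A B v (c - v) U w"
  shows "outer_approx (P \<inter> {x. w \<bullet> x \<ge> w \<bullet> v + t}) c"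
proof -
  have "v \<in> L" "v \<noteq> c" using outer_approx_ext[OF assms(1)] assms(2) by auto
  then have "w \<bullet> v + t \<le> w \<bullet> z" if "z \<in> S" for z
    using cut_valid[OF _ _ _ assms(3,4) that] assms(1) by (simp add: outer_approx_def)
  then show ?thesis
    using assms(1) by (auto simp: outer_approx_def intro!: polyhedron_Int polyhedron_halfspace_ge)
qed

text \<open>The clause for \<open>Cut_Output\<close> is the interface to the outer algorithm:
  enclosing the base later puts the recession directions into the interior of the cone, and lying in
  \<open>L\<close> keeps the generators on the base hyperplane.\<close>

primrec invariant :: "(real^'n) cutting_state \<Rightarrow> bool" where
  "invariant Cut_Start = True"
| "invariant (Cutting P c \<kappa>) = outer_approx P c"
| "invariant (Cut_Output V) = (finite V \<and> S \<subseteq> convex hull V \<and> V \<subseteq> L)"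

lemma invariant_step:
  assumes "invariant s" and "cutting_step A0 A L B \<epsilon> s s'"
  shows "invariant s'"
  using assms(2,1)
proof cases
  case (init X P c)
  then show ?thesis using initial_outer_approx by simp
next
  case (cut \<kappa> P c X T U W vb)
  then show ?thesis using assms(1) cut_outer_approx[of P c vb "X vb" "T vb" "U vb" "W vb"] by simp
next
  case (stop \<kappa> P c)
  then show ?thesis using assms(1) outer_approx_ext[of P c] by (auto simp: outer_approx_def)
qed

lemma cutting_progress:
  assumes "invariant s"
  shows "(\<exists>V. s = Cut_Output V) \<or> (\<exists>s'. cutting_step A0 A L B \<epsilon> s s')"
proof (cases s)
  case Cut_Start
  have "\<exists>x. solves_P1 S w x" for w
  proof -
    have "continuous_on S (\<lambda>x. w \<bullet> x)" by (intro continuous_intros)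
    from continuous_attains_sup[OF compact nonempty this] show ?thesis
      by (auto simp: solves_P1_def)
  qed
  then obtain X where X: "\<forall>w \<in> initial_directions B. solves_P1 S w (X w)" by metis
  obtain c where "c \<in> rel_interior S" using rel_interior_eq_empty[OF convex_S] nonempty by blast
  then have "\<exists>c. admissible_centre S a c" for a by (auto simp: admissible_centre_def)
  then show ?thesis using cutting_step.init[OF X refl] Cut_Start by blast
next
  case (Cutting P c \<kappa>)
  then have P: "outer_approx P c" using assms by simp
  note ext = outer_approx_ext[OF P]
  show ?thesis
  proof (cases "\<kappa> > ereal \<epsilon>")
    case False
    then show ?thesis using cutting_step.stop ext(1) Cutting by blast
  next
    case True
    have c: "c \<in> rel_interior S" using P by (simp add: outer_approx_def)
    have "\<forall>v\<in>ext P. \<exists>x t U w. solves_P2 A0 A v (c - v) x t \<and> solves_D2 A0 A B v (c - v) U w"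
    proof
      fix v assume "v \<in> ext P"
      then have v: "v \<in> L" "v \<noteq> c" using ext by auto
      obtain x t where P2: "solves_P2 A0 A v (c - v) x t"
        using P2_solvable[OF v(1) _ v(2)] c rel_interior_subset by blast
      with D2_solvable[OF v(1) c v(2) P2]
      show "\<exists>x t U w. solves_P2 A0 A v (c - v) x t \<and> solves_D2 A0 A B v (c - v) U w" by blast
    qed
    then obtain X T U W where sol:
      "\<forall>v\<in>ext P. solves_P2 A0 A v (c - v) (X v) (T v) \<and> solves_D2 A0 A B v (c - v) (U v) (W v)"
      by metis
    obtain vb where "vb \<in> ext P" "\<forall>v\<in>ext P. T v * norm (c - v) \<le> T vb * norm (c - vb)"
      using Max_in[of "(\<lambda>v. T v * norm (c - v)) ` ext P"] Max_ge[of "(\<lambda>v. T v * norm (c - v)) ` ext P"]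
        ext(1,3) by fastforce
    then show ?thesis using cutting_step.cut[OF True ext(1) sol] Cutting by blast
  qed
qed simp

text \<open>In an infinite run the normals of the cuts are bounded and the depths of the cuts are bounded
  below. As every vertex satisfies all earlier cuts, the vertices that are cut off would form a
  uniformly separated infinite subset of a compact set.\<close>

lemma no_infinite_cutting:
  "\<nexists>f. f 0 = Cut_Start \<and> (\<forall>k. invariant (f k) \<and> cutting_step A0 A L B \<epsilon> (f k) (f (Suc k)))"
proof
  assume "\<exists>f. f 0 = Cut_Start \<and> (\<forall>k. invariant (f k) \<and> cutting_step A0 A L B \<epsilon> (f k) (f (Suc k)))"
  then obtain f where f: "\<And>k. invariant (f k)" "\<And>k. cutting_step A0 A L B \<epsilon> (f k) (f (Suc k))"
    by blast
  \<comment> \<open>\<open>Cut_Start\<close> has no predecessor and \<open>Cut_Output\<close> no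
    successor.\<close>
  have "\<exists>P c \<kappa>. f (Suc k) = Cutting P c \<kappa>" for k
  proof (cases "f (Suc k)")
    case Cut_Start
    with f(2)[of k] show ?thesis by (auto elim: cutting_step.cases)
  next
    case (Cut_Output V)
    with f(2)[of "Suc k"] show ?thesis by (auto elim: cutting_step.cases)
  qed auto
  then obtain P c \<kappa> where state: "\<And>k. f (Suc k) = Cutting (P k) (c k) (\<kappa> k)" by metis
  have step: "\<kappa> k > ereal \<epsilon> \<and> c (Suc k) = c k \<and> (\<exists>v x t U w. v \<in> ext (P k)
      \<and> solves_P2 A0 A v (c k - v) x t \<and> solves_D2 A0 A B v (c k - v) U w
      \<and> P (Suc k) = P k \<inter> {x. w \<bullet> x \<ge> w \<bullet> v + t} \<and> \<kappa> (Suc k) = ereal (t * norm (c k - v)))" for k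
    using f(2)[of "Suc k"] unfolding state
    by cases blast
  define z where "z = c 0"
  have c: "c k = z" for k by (induction k) (use step in \<open>auto simp: z_def\<close>)
  obtain v x t U w where v: "\<And>k. v k \<in> ext (P k)"
      and P2: "\<And>k. solves_P2 A0 A (v k) (z - v k) (x k) (t k)"
      and D2: "\<And>k. solves_D2 A0 A B (v k) (z - v k) (U k) (w k)"
      and P_Suc: "\<And>k. P (Suc k) = P k \<inter> {x. w k \<bullet> x \<ge> w k \<bullet> v k + t k}"
      and \<kappa>_Suc: "\<And>k. \<kappa> (Suc k) = ereal (t k * norm (z - v k))"
    using step unfolding c by metis
  \<comment> \<open>The depth of a cut is bounded by the guard of the next iteration, since the run
    never stops.\<close>
  have depth: "\<epsilon> < t k * norm (z - v k)" for k
    using step[of "Suc k"] \<kappa>_Suc[of k] by simp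
  have approx: "outer_approx (P k) z" for k
    using f(1)[of "Suc k"] by (simp add: state c)
  have anti: "P k \<subseteq> P j" if "j \<le> k" for j k
    using that by (induction rule: dec_induct) (auto simp: P_Suc)
  have cri: "z \<in> rel_interior S" using approx[of 0] by (simp add: outer_approx_def)
  obtain e where e: "e > 0" "\<And>y. y \<in> span B \<Longrightarrow> norm y \<le> e \<Longrightarrow> z + y \<in> S"
    using rel_interior_ball[OF cri] by blast
  have vP: "v k \<in> P k" for k using v[of k] by (simp add: ext_def extreme_point_of_def)
  have comp: "compact (P 0)"
    using approx[of 0] by (simp add: outer_approx_def compact_eq_bounded_closed polyhedron_imp_closed)
  have v0: "v k \<in> P 0" for k using vP anti[of 0 k] by auto
  obtain M where M: "M > 0" "\<And>x. x \<in> P 0 \<Longrightarrow> norm x \<le> M"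
    using compact_imp_bounded[OF comp] by (auto simp: bounded_pos)
  define D where "D = norm z + M"
  have D: "D > 0" "\<And>k. norm (z - v k) \<le> D"
    using M v0 by (auto simp: D_def intro!: order_trans[OF norm_triangle_ineq4] add_nonneg_pos)
  have t: "t k > \<epsilon> / D" "t k > 0" for k
  proof -
    show pos: "t k > 0"
    proof (rule ccontr)
      assume "\<not> t k > 0"
      then have "t k * norm (z - v k) \<le> 0" by (simp add: mult_nonpos_nonneg)
      then show False using depth[of k] eps by simp
    qed
    have "\<epsilon> < t k * D" using depth[of k] mult_left_mono[OF D(2)[of k], of "t k"] pos by linarith
    then show "t k > \<epsilon> / D" using D(1) by (simp add: field_simps)
  qed
  \<comment> \<open>The separation of the vertices: each \<open>t k\<close> exceeds
    \<open>\<epsilon> / D\<close>, and each normal has norm at most \<open>1 / e\<close>.\<close>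
  define \<eta> where "\<eta> = e * (\<epsilon> / D)"
  have \<eta>: "\<eta> > 0" using e(1) eps D(1) by (simp add: \<eta>_def)
  obtain j k where jk: "j < k" "dist (v j) (v k) < \<eta>"
    by (rule close_pair_in_compact[where v = v, OF comp v0 \<eta>]) blast
  have "v k \<in> P (Suc j)" using vP[of k] anti[of "Suc j" k] jk(1) by auto
  then have "w j \<bullet> v j + t j \<le> w j \<bullet> v k" by (simp add: P_Suc)
  then have "t j \<le> w j \<bullet> (v k - v j)" by (simp add: inner_diff_right)
  also have "\<dots> \<le> norm (w j) * dist (v j) (v k)"
    using norm_cauchy_schwarz[of "w j" "v k - v j"] by (simp add: dist_norm norm_minus_commute)
  finally have "e * t j \<le> (e * norm (w j)) * dist (v j) (v k)" using e(1) by simp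
  also have "\<dots> \<le> 1 * dist (v j) (v k)"
  proof (intro mult_right_mono cut_normal_bound[OF _ cri _ P2 D2 t(2) e])
    show "v j \<in> L" "v j \<noteq> z" using outer_approx_ext[OF approx[of j]] v[of j] by auto
  qed auto
  also have "\<dots> < e * (\<epsilon> / D)" using jk(2) by (simp add: \<eta>_def)
  finally show False using mult_strict_left_mono[OF t(1)[of j] e(1)] by linarith
qed

lemma cutting_converges:
  "converges (cutting_step A0 A L B \<epsilon>)
     (\<lambda>s. \<exists>V. s = Cut_Output V \<and> finite V \<and> S \<subseteq> convex hull V \<and> V \<subseteq> L) Cut_Start"
proof (rule converges_if_invariant[where I = invariant])
  show "(\<exists>V. s = Cut_Output V \<and> finite V \<and> S \<subseteq> convex hull V \<and> V \<subseteq> L)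
      \<or> (\<exists>s'. cutting_step A0 A L B \<epsilon> s s')" if "invariant s" for s
    using cutting_progress[OF that] that by auto
qed (use no_infinite_cutting invariant_step in auto)

end

section \<open>The algorithm for unbounded spectrahedra\<close>

lemma l1_ball_bounded_by: "x \<in> l1_ball r \<Longrightarrow> norm x \<le> r"
  using norm_le_l1_cart[of x] by (simp add: l1_ball_def)

text \<open>The l1-norm is the maximum of the functionals given by sign vectors, attained at the
  sign pattern of \<open>x\<close>, so finitely many halfspaces suffice.\<close>

lemma polytope_l1_ball: "polytope (l1_ball r :: (real^'n) set)"
proof -
  define s :: "'n set \<Rightarrow> real^'n" where "s J = (\<chi> i. if i \<in> J then 1 else - 1)" for J
  have le: "s J \<bullet> x \<le> (\<Sum>i\<in>UNIV. \<bar>x $ i\<bar>)" for J x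
    by (auto simp: s_def inner_vec_def intro!: sum_mono)
  have eq: "s {i. x $ i \<ge> 0} \<bullet> x = (\<Sum>i\<in>UNIV. \<bar>x $ i\<bar>)" for x
    by (auto simp: s_def inner_vec_def intro!: sum.cong)
  have "(l1_ball r :: (real^'n) set) = \<Inter>((\<lambda>J. {x. s J \<bullet> x \<le> r}) ` UNIV)"
  proof (intro equalityI subsetI)
    fix x :: "real^'n" assume "x \<in> l1_ball r"
    then show "x \<in> \<Inter>((\<lambda>J. {x. s J \<bullet> x \<le> r}) ` UNIV)"
      using order_trans[OF le] by (auto simp: l1_ball_def)
  next
    fix x :: "real^'n" assume "x \<in> \<Inter>((\<lambda>J. {x. s J \<bullet> x \<le> r}) ` UNIV)"
    then have "s {i. x $ i \<ge> 0} \<bullet> x \<le> r" by blast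
    then show "x \<in> l1_ball r" by (simp add: eq l1_ball_def)
  qed
  then have "polyhedron (l1_ball r :: (real^'n) set)"
    by (auto intro!: polyhedron_Inter polyhedron_halfspace_le)
  moreover have "bounded (l1_ball r :: (real^'n) set)"
    using l1_ball_bounded_by by (auto simp: bounded_iff)
  ultimately show ?thesis by (simp add: polytope_eq_bounded_polyhedron)
qed

lemma cball_subset_l1_ball: "cball 0 (r / real CARD('n)) \<subseteq> (l1_ball r :: (real^'n) set)"
proof
  fix x :: "real^'n" assume "x \<in> cball 0 (r / real CARD('n))"
  then have x: "norm x \<le> r / real CARD('n)" by simp
  have "(\<Sum>i\<in>UNIV. \<bar>x $ i\<bar>) \<le> real CARD('n) * (r / real CARD('n))"
    by (rule sum_bounded_above) (use x component_le_norm_cart order_trans in blast)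
  then show "x \<in> l1_ball r" by (simp add: l1_ball_def)
qed

lemma orthonormal_frame_exists:
  assumes "affine L" and "L \<noteq> {}"
  shows "\<exists>B. orthonormal_frame L B"
proof -
  obtain a where a: "a \<in> L" using assms(2) by blast
  have "{x - y |x y. x \<in> L \<and> y \<in> L} = (\<lambda>x. x - a) ` L"
  proof (intro equalityI subsetI)
    fix z assume "z \<in> {x - y |x y. x \<in> L \<and> y \<in> L}"
    then obtain x y where "z = x - y" "x \<in> L" "y \<in> L" by blast
    then show "z \<in> (\<lambda>x. x - a) ` L"
      using mem_affine_3_minus[OF assms(1) a, of x y 1] by (auto intro!: image_eqI[of _ _ "a + (x - y)"])
  qed (use a in blast)
  then have sub: "subspace {x - y |x y. x \<in> L \<and> y \<in> L}"
    using affine_diffs_subspace_subtract[OF assms(1) a] by simp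
  obtain B where "pairwise orthogonal B" "\<And>b. b \<in> B \<Longrightarrow> norm b = 1"
      "span B = {x - y |x y. x \<in> L \<and> y \<in> L}"
    by (rule orthonormal_basis_subspace[OF sub]) blast
  then have "orthonormal_frame L B" by (simp add: orthonormal_frame_def)
  then show ?thesis ..
qed

lemma orthonormal_frame_Basis: "orthonormal_frame UNIV (Basis :: 'a::euclidean_space set)"
proof -
  have "x \<in> {x - y |x y. x \<in> (UNIV :: 'a set) \<and> y \<in> UNIV}" for x :: 'a
    by (intro CollectI exI[of _ x] exI[of _ 0]) simp
  then show ?thesis
    unfolding orthonormal_frame_def
    by (auto simp: pairwise_def orthogonal_def inner_Basis span_Basis)
qed

locale line_free_spectrahedron =
  fixes A0 :: "real^'m^'m" and A :: "'n::finite \<Rightarrow> real^'m^'m" and \<epsilon> \<delta> :: real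
  assumes pos: "\<epsilon> > 0" "\<delta> > 0"
    and sym: "transpose A0 = A0" "\<And>i. transpose (A i) = A i"
    and unbounded: "\<not> bounded (spectrahedron A0 A)"
    and line_free: "line_free (spectrahedron A0 A)"
    and interior: "interior (spectrahedron A0 A) \<noteq> {}"
begin

abbreviation "C \<equiv> spectrahedron A0 A"
abbreviation "w \<equiv> trace_direction A"
abbreviation "M \<equiv> cone_base A0 A \<delta>"

lemma nonempty: "C \<noteq> {}"
  using interior interior_subset by blast

text \<open>A kernel direction and its negative both have image 0, so they span a line in the
  recession cone.\<close>

lemma linear_pencil_inj: "linear_pencil A d = 0 \<Longrightarrow> d = 0"
proof -
  assume d: "linear_pencil A d = 0"
  then have "psd (linear_pencil A d)" "psd (linear_pencil A (- d))"
    by (simp_all add: linear_neg[OF linear_linear_pencil] psd_zero)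
  then have "d \<in> recession_cone C \<inter> uminus ` recession_cone C"
    using image_eqI[of d uminus "- d"] by (simp add: recession_cone_spectrahedron[OF nonempty])
  then show "d = 0" using line_free unfolding line_free_def by blast
qed

lemma w_neg: "psd (linear_pencil A d) \<Longrightarrow> d \<noteq> 0 \<Longrightarrow> w \<bullet> d < 0"
  using trace_direction_neg linear_pencil_inj by blast

lemma cone_base_eq: "M = spectrahedron 0 A \<inter> {x. w \<bullet> x = - (1 + \<delta>)}"
  unfolding cone_base_def recession_cone_spectrahedron[OF nonempty]
  by (auto simp: spectrahedron_def pencil_def)

lemma scale_into_base:
  assumes "psd (linear_pencil A d)" and "d \<noteq> 0"
  obtains s where "s > 0" and "s *\<^sub>R d \<in> M"
proof -
  define s where "s = (1 + \<delta>) / - (w \<bullet> d)"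
  have "s > 0" using w_neg[OF assms] pos by (simp add: s_def divide_pos_neg)
  moreover have "s * (w \<bullet> d) = - (1 + \<delta>)" using w_neg[OF assms] by (simp add: s_def)
  ultimately show thesis
    using that[of s] assms(1)
    by (simp add: cone_base_eq spectrahedron_def pencil_def linear_scale[OF linear_linear_pencil] psd_scaleR)
qed

lemma base_nonempty: "M \<noteq> {}"
proof -
  obtain x d where "\<And>k :: nat. x k \<in> C" "norm d = 1" "psd (linear_pencil A d)"
    by (rule unbounded_spectrahedron_direction[OF order_refl unbounded]) blast
  moreover from this have "d \<noteq> 0" by auto
  ultimately obtain s where "s *\<^sub>R d \<in> M" using scale_into_base by blast
  then show ?thesis by blast
qed

lemma compact_base: "compact M"
proof -
  have "compact ((spectrahedron 0 A \<inter> {x. - (1 + \<delta>) \<le> w \<bullet> x}) \<inter> {x. w \<bullet> x = - (1 + \<delta>)})"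
    by (intro compact_Int_closed compact_spectrahedron_slice linear_pencil_inj closed_hyperplane)
  moreover have "M = (spectrahedron 0 A \<inter> {x. - (1 + \<delta>) \<le> w \<bullet> x}) \<inter> {x. w \<bullet> x = - (1 + \<delta>)}"
    by (auto simp: cone_base_eq)
  ultimately show ?thesis by simp
qed

lemma base_hull_hyperplane: "affine hull M \<subseteq> {x. w \<bullet> x = - (1 + \<delta>)}"
  by (intro hull_minimal affine_hyperplane) (auto simp: cone_base_eq)

lemma base_hull_Int: "affine hull M \<inter> spectrahedron 0 A = M"
  using base_hull_hyperplane hull_subset[of M affine] by (auto simp: cone_base_eq)

lemma base_cutting_scheme:
  assumes "\<nexists>p. M = {p}" and "orthonormal_frame (affine hull M) B"
  shows "cutting_scheme 0 A (affine hull M) B (\<delta> / 2)"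
proof
  show "transpose (0 :: real^'m^'m) = 0" by (simp add: transpose_def vec_eq_iff)
qed (use assms pos sym compact_base in \<open>simp_all add: base_hull_Int\<close>)

text \<open>What thickening needs to know of \<open>Q\<close>, whether it is a single point or an
  output of the cutting scheme.\<close>

definition base_approx :: "(real^'n) set \<Rightarrow> bool" where
  "base_approx Q \<longleftrightarrow> (\<exists>V. finite V \<and> Q = convex hull V \<and> M \<subseteq> Q \<and> Q \<subseteq> {x. w \<bullet> x = - (1 + \<delta>)})"

text \<open>Finite generators serve the final output, negativity gives extreme points of
  \<open>C + K\<close> on the top face of \<open>C\<close>, and the interior condition bounds all
  extreme points.\<close>

definition approx_cone :: "(real^'n) set \<Rightarrow> bool" where
  "approx_cone K \<longleftrightarrow> (\<exists>D. finite D \<and> K = convex_cone hull D) \<and> (\<forall>k\<in>K. k \<noteq> 0 \<longrightarrow> w \<bullet> k < 0) \<and>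
     (\<forall>d. psd (linear_pencil A d) \<and> d \<noteq> 0 \<longrightarrow> d \<in> interior K)"

lemma
  assumes "base_approx Q"
  shows finite_ext_thickened: "finite (ext (Q + l1_ball (\<delta> / 2)))" (is "finite (ext ?Q)")
    and approx_cone_thickened: "approx_cone (convex_cone hull (ext (Q + l1_ball (\<delta> / 2))))"
proof -
  obtain V where V: "finite V" "Q = convex hull V" and M: "M \<subseteq> Q"
      and Q: "Q \<subseteq> {x. w \<bullet> x = - (1 + \<delta>)}"
    using assms by (auto simp: base_approx_def)
  obtain V' where V': "finite V'" "l1_ball (\<delta> / 2) = convex hull (V' :: (real^'n) set)"
    using polytope_l1_ball by (auto simp: polytope_def)
  have Q_hull: "?Q = convex hull (V + V')" by (simp add: V V' convex_hull_set_plus)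
  have fin: "finite (V + V')" using V V' by (simp add: finite_set_plus)
  have "ext ?Q \<subseteq> V + V'" unfolding Q_hull ext_def using extreme_point_of_convex_hull by blast
  then show finite: "finite (ext ?Q)" using fin finite_subset by blast
  have "compact ?Q" "convex ?Q"
    unfolding Q_hull using fin by (simp_all add: finite_imp_compact_convex_hull)
  then have KM: "convex hull (ext ?Q) = ?Q" unfolding ext_def by (rule Krein_Milman_Minkowski[symmetric])
  define K where "K = convex_cone hull (ext ?Q)"
  have K: "convex_cone K" by (simp add: K_def convex_cone_convex_cone_hull)
  have Q_K: "?Q \<subseteq> K"
    using convex_hull_subset_convex_cone_hull[of "ext ?Q"] by (simp add: KM K_def)
  \<comment> \<open>The base lies at level \<open>- (1 + \<delta>)\<close> and the thickening moves
    it by at most \<open>\<delta> / 2\<close>, so 0 stays strictly outside.\<close>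
  have neg: "w \<bullet> x < 0" if sum: "x \<in> ?Q" for x
  proof -
    obtain q b where x: "x = q + b" "q \<in> Q" "b \<in> l1_ball (\<delta> / 2)" using sum by (auto elim: set_plus_elim)
    have "w \<bullet> b \<le> norm w * norm b" by (rule norm_cauchy_schwarz)
    also have "\<dots> \<le> 1 * (\<delta> / 2)"
      using norm_trace_direction_le l1_ball_bounded_by[OF x(3)] pos by (intro mult_mono) auto
    finally show ?thesis using x Q pos by (auto simp: inner_add_right)
  qed
  have "K \<subseteq> insert 0 {x. w \<bullet> x < 0}"
    unfolding K_def
  proof (rule hull_minimal)
    show "ext ?Q \<subseteq> insert 0 {x. w \<bullet> x < 0}"
      using neg by (auto simp: ext_def extreme_point_of_def)
    show "convex_cone (insert 0 {x. w \<bullet> x < 0})"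
      by (auto simp: convex_cone_iff inner_add_right add_neg_neg mult_pos_neg)
  qed
  moreover have "d \<in> interior K" if d: "psd (linear_pencil A d)" "d \<noteq> 0" for d
  proof -
    obtain s where s: "s > 0" "s *\<^sub>R d \<in> M" using scale_into_base[OF d] by blast
    define e where "e = \<delta> / 2 / real CARD('n)"
    have "e > 0" using pos by (simp add: e_def)
    \<comment> \<open>A ball of radius \<open>e\<close> around the base point
      \<open>s *\<^sub>R d\<close> lies in the thickened base; the cone property scales it back to
      \<open>d\<close>.\<close>
    have "ball d (e / s) \<subseteq> K"
    proof
      fix y assume "y \<in> ball d (e / s)"
      then have "norm (s *\<^sub>R (y - d)) \<le> e"
        using s(1) by (simp add: dist_norm norm_minus_commute pos_less_divide_eq mult.commute
            del: scaleR_right_diff_distrib)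
      then have "s *\<^sub>R (y - d) \<in> l1_ball (\<delta> / 2)"
        using cball_subset_l1_ball[where 'n = 'n, of "\<delta> / 2"] by (auto simp: e_def)
      then have "s *\<^sub>R d + s *\<^sub>R (y - d) \<in> ?Q" using s(2) M by (intro set_plus_intro) auto
      then have "s *\<^sub>R y \<in> K" using Q_K by (auto simp: algebra_simps)
      moreover have "0 \<le> 1 / s" using s(1) by simp
      ultimately have "(1 / s) *\<^sub>R (s *\<^sub>R y) \<in> K" by (intro convex_cone_scaleR[OF K, of "1 / s"])
      moreover have "(1 / s) *\<^sub>R (s *\<^sub>R y) = y" using s(1) by (simp only: scaleR_scaleR) simp
      ultimately show "y \<in> K" by (simp only:)
    qed
    moreover have "e / s > 0" using \<open>e > 0\<close> s(1) by simp
    ultimately show ?thesis unfolding mem_interior by blast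
  qed
  ultimately show "approx_cone (convex_cone hull (ext ?Q))"
    using finite unfolding approx_cone_def K_def[symmetric] by (auto simp: K_def)
qed

lemma C_attains_max:
  obtains f where "f \<in> C" and "\<And>x. x \<in> C \<Longrightarrow> w \<bullet> x \<le> w \<bullet> f"
proof -
  obtain z where z: "z \<in> C" using nonempty by blast
  let ?S = "C \<inter> {x. w \<bullet> z \<le> w \<bullet> x}"
  have "continuous_on ?S (\<lambda>x. w \<bullet> x)" by (intro continuous_intros)
  then obtain f where "f \<in> ?S" "\<forall>x\<in>?S. w \<bullet> x \<le> w \<bullet> f"
    using continuous_attains_sup[OF compact_spectrahedron_slice, of A A0] linear_pencil_inj z by blast
  then show thesis using that[of f] by force
qed

section \<open>The sum of the spectrahedron and a fixed approximating cone\<close>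

context
  fixes K assumes K: "approx_cone K"
begin

lemma convex_cone_K: "convex_cone K"
  using K by (auto simp: approx_cone_def convex_cone_convex_cone_hull)

lemma zero_in_K: "0 \<in> K"
  using convex_cone_K by (rule convex_cone_contains_0)

text \<open>The point is the midpoint of \<open>c\<close> and
  \<open>c + 2 *\<^sub>R k\<close>.\<close>

lemma add_not_extreme:
  assumes "c \<in> C" and "k \<in> K" and "k \<noteq> 0"
  shows "c + k \<notin> ext (C + K)"
proof
  assume "c + k \<in> ext (C + K)"
  moreover have "c + 0 \<in> C + K" "c + 2 *\<^sub>R k \<in> C + K"
    using assms by (auto intro!: set_plus_intro zero_in_K convex_cone_scaleR[OF convex_cone_K] simp del: add_0_right)
  moreover have "c + k \<in> open_segment (c + 0) (c + 2 *\<^sub>R k)"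
  proof -
    have "c + k = midpoint (c + 0) (c + 2 *\<^sub>R k)"
      by (simp add: midpoint_def vec_eq_iff)
    then show ?thesis using assms(3) by (simp only: midpoint_in_open_segment) simp
  qed
  ultimately show False by (auto simp: ext_def extreme_point_of_def)
qed

lemma ext_sum_subset: "ext (C + K) \<subseteq> C"
proof
  fix x assume x: "x \<in> ext (C + K)"
  then obtain c k where "x = c + k" "c \<in> C" "k \<in> K"
    by (auto simp: ext_def extreme_point_of_def elim: set_plus_elim)
  with x add_not_extreme show "x \<in> C" by (cases "k = 0") auto
qed

text \<open>Far away points of C differ from a fixed point of C by an element of K, since the
  directions towards infinity lie in the interior of K.\<close>

lemma bounded_ext_sum: "bounded (ext (C + K))"
proof (rule ccontr)
  assume "\<not> bounded (ext (C + K))"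
  then obtain x d where x: "\<And>k :: nat. x k \<in> ext (C + K)"
    "filterlim (\<lambda>k. norm (x k)) at_top sequentially"
    "(\<lambda>k. x k /\<^sub>R norm (x k)) \<longlonglongrightarrow> d" "norm d = 1" "psd (linear_pencil A d)"
    by (rule unbounded_spectrahedron_direction[OF ext_sum_subset]) blast
  obtain z where z: "z \<in> C" using nonempty by blast
  have "d \<noteq> 0" using x(4) by auto
  then have d: "d \<in> interior K" using K x(5) by (auto simp: approx_cone_def)
  \<comment> \<open>After scaling, the fixed point \<open>z\<close> disappears in the limit, so
    \<open>x k - z\<close> eventually points into the interior of \<open>K\<close>.\<close>
  have "(\<lambda>k. x k /\<^sub>R norm (x k) - inverse (norm (x k)) *\<^sub>R z) \<longlonglongrightarrow> d - 0 *\<^sub>R z"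
    by (intro tendsto_intros x(3) tendsto_inverse_0_at_top x(2))
  then have "eventually (\<lambda>k. x k /\<^sub>R norm (x k) - inverse (norm (x k)) *\<^sub>R z \<in> interior K) sequentially"
    using d by (intro topological_tendstoD) auto
  \<comment> \<open>This gives \<open>x k \<noteq> 0\<close> for the rescaling and
    \<open>x k \<noteq> z\<close> for \<open>add_not_extreme\<close>.\<close>
  moreover have "eventually (\<lambda>k. norm (x k) > norm z) sequentially"
    using x(2) by (simp add: filterlim_at_top_dense)
  ultimately have "eventually (\<lambda>k. False) sequentially"
  proof eventually_elim
    case (elim k)
    have pos: "norm (x k) > 0" using elim(2) norm_ge_zero[of z] by linarith
    have "x k /\<^sub>R norm (x k) - inverse (norm (x k)) *\<^sub>R z \<in> K" using elim(1) interior_subset by blast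
    then have "norm (x k) *\<^sub>R (x k /\<^sub>R norm (x k) - inverse (norm (x k)) *\<^sub>R z) \<in> K"
      by (intro convex_cone_scaleR[OF convex_cone_K]) auto
    then have "x k - z \<in> K" using pos by (simp add: scaleR_right_diff_distrib)
    moreover have "x k - z \<noteq> 0" using elim(2) by auto
    ultimately have "z + (x k - z) \<notin> ext (C + K)" by (rule add_not_extreme[OF z])
    then show False using x(1) by simp
  qed
  then show False by simp
qed

text \<open>As \<open>w\<close> is negative on the nonzero part of \<open>K\<close>, the face of
  \<open>C + K\<close> where \<open>w\<close> is maximal is the compact top face of
  \<open>C\<close>. It has an extreme point, and extreme points of a face are extreme in the whole
  set.\<close>

lemma ext_sum_attains_max:
  assumes f: "f \<in> C" "\<And>x. x \<in> C \<Longrightarrow> w \<bullet> x \<le> w \<bullet> f"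
  obtains e where "e \<in> ext (C + K)" and "w \<bullet> e = w \<bullet> f"
proof -
  let ?H = "{x. w \<bullet> x = w \<bullet> f}"
  have "compact ((C \<inter> {x. w \<bullet> f \<le> w \<bullet> x}) \<inter> ?H)"
    by (intro compact_Int_closed compact_spectrahedron_slice linear_pencil_inj closed_hyperplane)
  moreover have "(C \<inter> {x. w \<bullet> f \<le> w \<bullet> x}) \<inter> ?H = C \<inter> ?H" by auto
  ultimately have "compact (C \<inter> ?H)" by simp
  moreover have "convex (C \<inter> ?H)" by (intro convex_Int convex_spectrahedron convex_hyperplane)
  moreover have "C \<inter> ?H \<noteq> {}" using f(1) by auto
  ultimately obtain e where e: "e extreme_point_of (C \<inter> ?H)" using extreme_point_exists_convex by blast
  have le: "w \<bullet> (c + k) \<le> w \<bullet> f \<and> (w \<bullet> (c + k) = w \<bullet> f \<longrightarrow> k = 0)" if "c \<in> C" "k \<in> K" for c k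
    using f(2)[OF that(1)] K that(2) by (cases "k = 0") (auto simp: approx_cone_def inner_add_right)
  have "convex (C + K)"
    using convex_spectrahedron convex_cone_K by (intro convex_set_plus) (auto simp: convex_cone_def)
  then have "((C + K) \<inter> ?H) face_of (C + K)"
    using le by (intro face_of_Int_supporting_hyperplane_le) (auto elim!: set_plus_elim)
  moreover have "(C + K) \<inter> ?H = C \<inter> ?H"
  proof (intro equalityI subsetI)
    fix x assume "x \<in> (C + K) \<inter> ?H"
    then obtain c k where "x = c + k" "c \<in> C" "k \<in> K" "w \<bullet> x = w \<bullet> f" by (auto elim: set_plus_elim)
    then show "x \<in> C \<inter> ?H" using le[of c k] by auto
  next
    fix x assume "x \<in> C \<inter> ?H"
    then show "x \<in> (C + K) \<inter> ?H" using set_plus_intro[OF _ zero_in_K, of x C] by auto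
  qed
  ultimately have "e \<in> ext (C + K)" using e extreme_point_of_face by (auto simp: ext_def)
  moreover have "w \<bullet> e = w \<bullet> f" using e by (auto simp: extreme_point_of_def)
  ultimately show thesis by (rule that)
qed

lemma extreme_values_nonempty: "extreme_values A0 A K \<noteq> {}"
proof -
  obtain f where "f \<in> C" "\<And>x. x \<in> C \<Longrightarrow> w \<bullet> x \<le> w \<bullet> f" using C_attains_max by blast
  then obtain e where "e \<in> ext (C + K)" using ext_sum_attains_max by blast
  then show ?thesis by (auto simp: extreme_values_def)
qed

lemma bdd_below_extreme_values: "bdd_below (extreme_values A0 A K)"
proof -
  have "bounded ((\<lambda>y. w \<bullet> y) ` (convex hull (ext (C + K))))"
    by (intro bounded_linear_image bounded_convex_hull bounded_ext_sum bounded_linear_inner_right)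
  then show ?thesis unfolding extreme_values_def by (rule bounded_imp_bdd_below)
qed

lemma trunc_cutting_scheme:
  "cutting_scheme (trunc_const A0 A \<epsilon> K) (trunc_coeff A) UNIV Basis \<epsilon>"
proof -
  define l where "l = truncation_level A0 A \<epsilon> K"
  obtain f where f: "f \<in> C" "\<And>x. x \<in> C \<Longrightarrow> w \<bullet> x \<le> w \<bullet> f" using C_attains_max by blast
  then obtain e where e: "e \<in> ext (C + K)" "w \<bullet> e = w \<bullet> f" using ext_sum_attains_max by blast
  have "w \<bullet> e \<in> extreme_values A0 A K" using e(1) by (auto simp: extreme_values_def hull_inc)
  then have "Inf (extreme_values A0 A K) \<le> w \<bullet> f"
    using cInf_lower[OF _ bdd_below_extreme_values] e(2) by simp
  \<comment> \<open>The subtraction of \<open>\<epsilon>\<close> in \<open>truncation_level\<close>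
    makes this strict; hence the truncation has interior points near \<open>f\<close>.\<close>
  then have lf: "l < w \<bullet> f" using pos by (simp add: l_def truncation_level_def)
  define T where "T = C \<inter> {x. l \<le> w \<bullet> x}"
  have T: "spectrahedron (trunc_const A0 A \<epsilon> K) (trunc_coeff A) = T"
    by (simp add: spectrahedron_trunc T_def l_def)
  have "f \<in> closure (interior C)"
    using f(1) closure_subset convex_closure_interior[OF convex_spectrahedron interior] by blast
  then have "{x. l < w \<bullet> x} \<inter> interior C \<noteq> {}"
    using lf open_Int_closure_eq_empty[OF open_halfspace_gt, of l w "interior C"] by auto
  moreover have "{x. l < w \<bullet> x} \<inter> interior C \<subseteq> interior T"
    using interior_subset by (intro interior_maximal open_Int open_halfspace_gt open_interior) (auto simp: T_def)
  ultimately have int: "interior T \<noteq> {}" by blast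
  show ?thesis
  proof
    show "compact (UNIV \<inter> spectrahedron (trunc_const A0 A \<epsilon> K) (trunc_coeff A))"
      using compact_spectrahedron_slice[OF linear_pencil_inj] by (simp add: T T_def)
    show "affine hull (UNIV \<inter> spectrahedron (trunc_const A0 A \<epsilon> K) (trunc_coeff A)) = UNIV"
      using affine_hull_nonempty_interior[OF int] by (simp add: T)
    show "UNIV \<inter> spectrahedron (trunc_const A0 A \<epsilon> K) (trunc_coeff A) \<noteq> {p}" for p
      using int by (auto simp: T)
  qed (use pos sym orthonormal_frame_Basis in \<open>auto simp: trunc_const_def trunc_coeff_def transpose_append_diag\<close>)
qed

lemma approx_trunc_converges: "converges (alg_step A0 A \<epsilon> \<delta>) is_returned (Approx_Trunc K Cut_Start)"
proof (rule converges_embed[OF cutting_scheme.cutting_converges[OF trunc_cutting_scheme]])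
  fix s t
  show "\<exists>t. alg_step A0 A \<epsilon> \<delta> (Approx_Trunc K s) t"
    if out: "\<exists>V. s = Cut_Output V \<and> finite V
       \<and> UNIV \<inter> spectrahedron (trunc_const A0 A \<epsilon> K) (trunc_coeff A) \<subseteq> convex hull V \<and> V \<subseteq> UNIV"
  proof -
    obtain V where V: "s = Cut_Output V" "finite V" using out by blast
    obtain D where "finite D" "K = convex_cone hull D" using K by (auto simp: approx_cone_def)
    then show ?thesis using alg_step.finish[where K = K and D' = D, OF V(2)] V(1) by blast
  qed
  have returned: "converges (alg_step A0 A \<epsilon> \<delta>) is_returned (Returned V D)" for V D
    by (rule converges.intros) (auto simp: is_returned_def elim: alg_step.cases)
  assume "alg_step A0 A \<epsilon> \<delta> (Approx_Trunc K s) t"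
  then show "(\<exists>s'. cutting_step (trunc_const A0 A \<epsilon> K) (trunc_coeff A) UNIV Basis \<epsilon> s s' \<and> t = Approx_Trunc K s')
      \<or> converges (alg_step A0 A \<epsilon> \<delta>) is_returned t"
    by cases (use returned in auto)
qed (rule alg_step.trunc_run)

end

lemma have_base_converges:
  assumes "base_approx Q"
  shows "converges (alg_step A0 A \<epsilon> \<delta>) is_returned (Have_Base Q)"
proof (rule converges.intros)
  let ?K = "convex_cone hull (ext (Q + l1_ball (\<delta> / 2)))"
  note fin = finite_ext_thickened[OF assms] and K = approx_cone_thickened[OF assms]
  show "is_returned (Have_Base Q) \<or> (\<exists>t. alg_step A0 A \<epsilon> \<delta> (Have_Base Q) t)"
    using alg_step.trunc_start[OF fin refl extreme_values_nonempty[OF K] bdd_below_extreme_values[OF K]]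
    by blast
  fix t assume "alg_step A0 A \<epsilon> \<delta> (Have_Base Q) t"
  then have "t = Approx_Trunc ?K Cut_Start" by cases auto
  then show "converges (alg_step A0 A \<epsilon> \<delta>) is_returned t" using approx_trunc_converges[OF K] by simp
qed

lemma approx_base_converges:
  assumes "\<nexists>p. M = {p}" and "orthonormal_frame (affine hull M) B"
  shows "converges (alg_step A0 A \<epsilon> \<delta>) is_returned (Approx_Base B Cut_Start)"
proof (rule converges_embed[OF cutting_scheme.cutting_converges[OF base_cutting_scheme[OF assms]]])
  fix s t
  let ?out = "\<exists>V. s = Cut_Output V \<and> finite V
       \<and> affine hull M \<inter> spectrahedron 0 A \<subseteq> convex hull V \<and> V \<subseteq> affine hull M"
  show "\<exists>t. alg_step A0 A \<epsilon> \<delta> (Approx_Base B s) t" if ?out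
    using that alg_step.base_finish by blast
  assume live: "?out \<or> (\<exists>s'. cutting_step 0 A (affine hull M) B (\<delta> / 2) s s')"
  assume "alg_step A0 A \<epsilon> \<delta> (Approx_Base B s) t"
  then show "(\<exists>s'. cutting_step 0 A (affine hull M) B (\<delta> / 2) s s' \<and> t = Approx_Base B s')
      \<or> converges (alg_step A0 A \<epsilon> \<delta>) is_returned t"
  proof cases
    case (base_finish V)
    \<comment> \<open>An output state admits no cutting step, so \<open>live\<close> supplies the
      facts about \<open>V\<close>.\<close>
    then have "?out" using live by (auto elim: cutting_step.cases)
    then have V: "finite V" "M \<subseteq> convex hull V" "V \<subseteq> affine hull M"
      using base_finish by (auto simp: base_hull_Int)
    have "convex hull V \<subseteq> {x. w \<bullet> x = - (1 + \<delta>)}"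
      using V(3) base_hull_hyperplane by (intro hull_minimal convex_hyperplane) auto
    then have "base_approx (convex hull V)" using V by (auto simp: base_approx_def)
    then show ?thesis using have_base_converges base_finish by simp
  qed auto
qed (rule alg_step.base_run)

lemma alg_converges: "converges (alg_step A0 A \<epsilon> \<delta>) is_returned Start"
proof (rule converges.intros)
  show "is_returned Start \<or> (\<exists>t. alg_step A0 A \<epsilon> \<delta> Start t)"
  proof (cases "\<exists>p. M = {p}")
    case True
    then show ?thesis using alg_step.base_point by blast
  next
    case False
    obtain B where "orthonormal_frame (affine hull M) B"
      using orthonormal_frame_exists[of "affine hull M"] base_nonempty by (auto simp: affine_affine_hull)
    then show ?thesis using alg_step.base_start[OF False] by blast
  qed
  fix t assume "alg_step A0 A \<epsilon> \<delta> Start t"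
  then show "converges (alg_step A0 A \<epsilon> \<delta>) is_returned t"
  proof cases
    case (base_point p)
    have "base_approx {p}"
      unfolding base_approx_def using base_point(2) cone_base_eq by (intro exI[of _ "{p}"]) auto
    then show ?thesis using have_base_converges base_point(1) by simp
  next
    case (base_start B)
    then show ?thesis using approx_base_converges by simp
  qed
qed

end

theorem corollary5p7:
  fixes A0 :: "real^'m^'m" and A :: "'n::finite \<Rightarrow> real^'m^'m"
    and C :: "(real^'n) set" and \<epsilon> \<delta> :: real
  assumes "\<epsilon> > 0" and "\<delta> > 0"
    and "transpose A0 = A0" and "\<And>i. transpose (A i) = A i"
    and "C = spectrahedron A0 A"
    and "\<not> bounded C" and "closed C" and "convex C" and "line_free C"
    and "interior C \<noteq> {}"
  shows "terminates (alg_step A0 A \<epsilon> \<delta>) is_returned Start"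
proof -
  interpret line_free_spectrahedron A0 A \<epsilon> \<delta>
    using assms by unfold_locales auto
  show ?thesis using alg_converges by (rule converges_terminates)
qed

end
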